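(* Fix a normalised pure spinor $\psi_0\in\Delta^+$. In the open set $\{f=\langle\psi_0\psi\rangle\neq0\}$, the Plücker relations for $\Psi=[v;\psi;s]\in V\oplus\Delta^+\oplus\mathbb{C}$, $$2vs-\tfrac1{\sqrt2}(\psi e^i\psi)e^i=0,\qquad v\psi=0,\qquad v\cdot v=0,$$ are solved in terms of a $(2,0)$ tensor $K\in\wedge^2V$, a $(0,1)$ vector $\bar u\in V$ and two scalars $s,f\in\mathbb{C}$, $f\ne0$ (17 parameters in total): the solutions are $$v=-\tfrac12f^{-1}K\bar u+\bar u,$$ $$\psi=\psi_0f-\tfrac18K\psi_0+\tfrac1{\sqrt2}f^{-1}\Big(s\bar u+\tfrac1{32}\bar\Omega^{ipqrs}K^{pq}K^{rs}e^i\Big)C\psi_0^*.$$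
   Context: $V=\mathbb{C}^{10}$ has standard basis $e^1,\dots,e^{10}$ and complex bilinear inner product $e^i\cdot e^j=\delta^{ij}$; the Clifford algebra $e^ie^j+e^je^i=2\delta^{ij}$ acts on $\Delta=(\mathbb{C}^2)^{\otimes5}$ by the Hermitian matrices $e^{2k-1}=\sigma_3^{\otimes(k-1)}\otimes\sigma_1\otimes1^{\otimes(5-k)}$, $e^{2k}=\sigma_3^{\otimes(k-1)}\otimes\sigma_2\otimes1^{\otimes(5-k)}$ ($\sigma_i$ Pauli matrices); $\Delta^\pm$ are the $\pm1$ eigenspaces of $(-i)^5e^1\cdots e^{10}$. Put $C=e^1e^3e^5e^7e^9$, $(\phi\,a\,\psi)=\phi^TCa\psi$, $\langle\phi\,a\,\psi\rangle=\phi^\dagger a\psi$; $*$ is complex conjugation; $e^{i_1\cdots i_k}$ is the antisymmetrised product of $e^{i_1},\dots,e^{i_k}$ (normalised so that it equals $e^{i_1}\cdots e^{i_k}$ for distinct indices). Repeated indices are summed over $1,\dots,10$. In expressions such as $v\psi$, vectors act on spinors by Clifford multiplication. $\psi_0\in\Delta^+$ is pure if $(\psi_0e^i\psi_0)=0$ for all $i$, normalised if $\langle\psi_0\psi_0\rangle=1$. It defines a complex structure $J$ on $V$ by $Jv=\frac i2\langle\psi_0[e^i,v]\psi_0\rangle e^i$. A vector $w\in V$ is of type $(1,0)$ if $Jw=iw$ and of type $(0,1)$ if $Jw=-iw$; $K=\frac12K^{ij}e^i\wedge e^j$ (with $K^{ij}=-K^{ji}$) is of type $(2,0)$ if it lies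 in $\wedge^2$ of the space of $(1,0)$ vectors. $K\psi_0:=K^{ij}e^{ij}\psi_0$ (sum over all $i,j$), $Kw:=K^{ij}w^je^i$ for $w\in V$, and $\bar\Omega^{i_1\cdots i_5}=\frac1{4\sqrt2}(\psi_0e^{i_1\cdots i_5}\psi_0)$. *)

theory Defs
  imports "HOL-Analysis.Analysis" "HOL-Combinatorics.Permutations"
begin

text \<open>
  The index type \<^typ>\<open>10\<close> has the elements 1, ..., 10, where 10 = 0; likewise
  \<^typ>\<open>2\<close> has the elements 1 and 2 = 0. The list constructor \<^const>\<open>vector\<close> fills
  the positions 1, 2, ... in this order. A tensor \<open>T\<^sup>i\<^sup>j\<close> on \<open>V = \<complex>\<^sup>1\<^sup>0\<close>
  has its components indexed by pairs, so that complex spans and dimensions of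
  tensors are those of the library.
\<close>

type_synonym cvec = "complex ^ 10"
type_synonym tensor2 = "complex ^ (10 \<times> 10)"
type_synonym spin_index = "2 \<times> 2 \<times> 2 \<times> 2 \<times> 2"
type_synonym spinor = "complex ^ spin_index"
type_synonym spin_op = "complex ^ spin_index ^ spin_index"

definition cdot :: "cvec \<Rightarrow> cvec \<Rightarrow> complex" where
  "cdot v w = (\<Sum>i\<in>UNIV. v $ i * w $ i)"

definition kron ::
    "complex ^ 'a ^ 'a \<Rightarrow> complex ^ 'b ^ 'b \<Rightarrow> complex ^ ('a \<times> 'b) ^ ('a \<times> 'b)"
    (infixr "\<otimes>" 75) where
  "A \<otimes> B = (\<chi> a b. A $ fst a $ fst b * B $ snd a $ snd b)"

definition pauli1 :: "complex ^ 2 ^ 2" where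
  "pauli1 = vector [vector [0, 1], vector [1, 0]]"

definition pauli2 :: "complex ^ 2 ^ 2" where
  "pauli2 = vector [vector [0, - \<i>], vector [\<i>, 0]]"

definition pauli3 :: "complex ^ 2 ^ 2" where
  "pauli3 = vector [vector [1, 0], vector [0, - 1]]"

definition gamma :: "10 \<Rightarrow> spin_op" where
  "gamma i = vector
    [pauli1 \<otimes> mat 1 \<otimes> mat 1 \<otimes> mat 1 \<otimes> mat 1,
     pauli2 \<otimes> mat 1 \<otimes> mat 1 \<otimes> mat 1 \<otimes> mat 1,
     pauli3 \<otimes> pauli1 \<otimes> mat 1 \<otimes> mat 1 \<otimes> mat 1,
     pauli3 \<otimes> pauli2 \<otimes> mat 1 \<otimes> mat 1 \<otimes> mat 1,
     pauli3 \<otimes> pauli3 \<otimes> pauli1 \<otimes> mat 1 \<otimes> mat 1,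
     pauli3 \<otimes> pauli3 \<otimes> pauli2 \<otimes> mat 1 \<otimes> mat 1,
     pauli3 \<otimes> pauli3 \<otimes> pauli3 \<otimes> pauli1 \<otimes> mat 1,
     pauli3 \<otimes> pauli3 \<otimes> pauli3 \<otimes> pauli2 \<otimes> mat 1,
     pauli3 \<otimes> pauli3 \<otimes> pauli3 \<otimes> pauli3 \<otimes> pauli1,
     pauli3 \<otimes> pauli3 \<otimes> pauli3 \<otimes> pauli3 \<otimes> pauli2] $ i"

definition gamma_prod :: "10 list \<Rightarrow> spin_op" where
  "gamma_prod is = foldr (\<lambda>i A. gamma i ** A) is (mat 1)"

definition gamma_asym :: "10 list \<Rightarrow> spin_op" where
  "gamma_asym is = (1 / fact (length is)) *\<^sub>R
    (\<Sum>p | p permutes {..<length is}.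
      of_int (sign p) *\<^sub>R gamma_prod (map (\<lambda>j. is ! p j) [0..<length is]))"

definition clifford :: "cvec \<Rightarrow> spin_op" where
  "clifford v = (\<Sum>i\<in>UNIV. mat (v $ i) ** gamma i)"

definition Delta_plus :: "spinor set" where
  "Delta_plus = {\<psi>. (- \<i>) ^ 5 *s (gamma_prod [1, 2, 3, 4, 5, 6, 7, 8, 9, 10] *v \<psi>) = \<psi>}"

definition charge_conj :: spin_op where
  "charge_conj = gamma_prod [1, 3, 5, 7, 9]"

definition spinor_cnj :: "spinor \<Rightarrow> spinor" where
  "spinor_cnj \<psi> = (\<chi> a. cnj (\<psi> $ a))"

definition bil :: "spinor \<Rightarrow> spin_op \<Rightarrow> spinor \<Rightarrow> complex" where
  "bil \<phi> A \<psi> = (\<Sum>a\<in>UNIV. \<phi> $ a * ((charge_conj ** A) *v \<psi>) $ a)"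

definition herm :: "spinor \<Rightarrow> spin_op \<Rightarrow> spinor \<Rightarrow> complex" where
  "herm \<phi> A \<psi> = (\<Sum>a\<in>UNIV. cnj (\<phi> $ a) * (A *v \<psi>) $ a)"

definition pure_spinor :: "spinor \<Rightarrow> bool" where
  "pure_spinor \<psi> \<longleftrightarrow> (\<forall>i. bil \<psi> (gamma i) \<psi> = 0)"

definition normalised :: "spinor \<Rightarrow> bool" where
  "normalised \<psi> \<longleftrightarrow> herm \<psi> (mat 1) \<psi> = 1"

definition J :: "spinor \<Rightarrow> cvec \<Rightarrow> cvec" where
  "J \<psi>0 v = (\<chi> i. \<i> / 2 * herm \<psi>0 (gamma i ** clifford v - clifford v ** gamma i) \<psi>0)"

definition type10 :: "spinor \<Rightarrow> cvec set" where
  "type10 \<psi>0 = {w. J \<psi>0 w = \<i> *s w}"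

definition type01 :: "spinor \<Rightarrow> cvec set" where
  "type01 \<psi>0 = {w. J \<psi>0 w = (- \<i>) *s w}"

text \<open>
  The components \<open>K\<^sup>i\<^sup>j\<close> are those in \<open>K = 1/2 K\<^sup>i\<^sup>j e\<^sup>i \<and> e\<^sup>j\<close>, so \<open>v \<and> w\<close>
  has the components \<open>v\<^sup>i w\<^sup>j - v\<^sup>j w\<^sup>i\<close>.
\<close>

definition wedge :: "cvec \<Rightarrow> cvec \<Rightarrow> tensor2" where
  "wedge v w = (\<chi> ij. v $ fst ij * w $ snd ij - v $ snd ij * w $ fst ij)"

definition type20 :: "spinor \<Rightarrow> tensor2 set" where
  "type20 \<psi>0 = vec.span {wedge v w | v w. v \<in> type10 \<psi>0 \<and> w \<in> type10 \<psi>0}"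

definition tensor_spinor :: "tensor2 \<Rightarrow> spinor \<Rightarrow> spinor" where
  "tensor_spinor K \<psi> = (\<Sum>i\<in>UNIV. \<Sum>j\<in>UNIV. K $ (i, j) *s (gamma_asym [i, j] *v \<psi>))"

definition tensor_vec :: "tensor2 \<Rightarrow> cvec \<Rightarrow> cvec" where
  "tensor_vec K w = (\<chi> i. \<Sum>j\<in>UNIV. K $ (i, j) * w $ j)"

definition Omega_bar :: "spinor \<Rightarrow> 10 \<Rightarrow> 10 \<Rightarrow> 10 \<Rightarrow> 10 \<Rightarrow> 10 \<Rightarrow> complex" where
  "Omega_bar \<psi>0 i p q r s =
    1 / (4 * complex_of_real (sqrt 2)) * bil \<psi>0 (gamma_asym [i, p, q, r, s]) \<psi>0"

definition Omega_KK :: "spinor \<Rightarrow> tensor2 \<Rightarrow> cvec" where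
  "Omega_KK \<psi>0 K = (\<chi> i. \<Sum>p\<in>UNIV. \<Sum>q\<in>UNIV. \<Sum>r\<in>UNIV. \<Sum>s\<in>UNIV.
    Omega_bar \<psi>0 i p q r s * K $ (p, q) * K $ (r, s))"

definition plucker :: "cvec \<Rightarrow> spinor \<Rightarrow> complex \<Rightarrow> bool" where
  "plucker v \<psi> s \<longleftrightarrow>
    (2 * s) *s v - (1 / complex_of_real (sqrt 2)) *s (\<chi> i. bil \<psi> (gamma i) \<psi>) = 0 \<and>
    clifford v *v \<psi> = 0 \<and>
    cdot v v = 0"

end

theory Submission
  imports Defs
begin

text \<open>
  A pure spinor \<open>\<psi>0\<close> behaves like the vacuum of a Fock space with five levels. Its annihilator
  \<open>N = {w. w \<psi>0 = 0}\<close> is the space of \<open>(0,1)\<close> vectors, the complex conjugate \<open>Nbar\<close> of \<open>N\<close> is the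
  space of \<open>(1,0)\<close> vectors, and \<open>Nbar\<close> annihilates the opposite vacuum \<open>\<psi>bar = C \<psi>0\<^sup>*\<close>. Everything
  is done without coordinates on \<open>V\<close>, by moving elements of \<open>N\<close> and \<open>Nbar\<close> through products until
  they reach one of the two vacua.

  The input special to ten dimensions is that the vector \<open>(\<psi> e\<^sup>i \<psi>)\<close> of a chiral spinor is
  null (\<open>chiral_vector_null\<close>). Polarised at a pure spinor it says that \<open>(\<psi>0 e\<^sup>i \<phi>) e\<^sup>i\<close> annihilates
  \<open>\<psi>0\<close> for each chiral \<open>\<phi>\<close> (\<open>current_in_N\<close>). Taking \<open>\<phi> = v \<psi>bar\<close> produces, up to a factor 2, the
  projection of \<open>V\<close> onto \<open>N\<close> along \<open>Nbar\<close>, so that \<open>V = N \<oplus> Nbar\<close> and both summands have dimension 5.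

  The spinors \<open>\<psi>0\<close>, \<open>K \<psi>0\<close> and \<open>w \<psi>bar\<close> with \<open>K\<close> of type \<open>(2,0)\<close> and \<open>w \<in> N\<close> are independent, and
  \<open>1 + 10 + 5 = 16\<close> is the dimension of \<open>\<Delta>\<^sup>+\<close>. Hence each chiral spinor is uniquely of the form
  \<open>f \<psi>0 - 1/8 K \<psi>0 + w \<psi>bar\<close> (\<open>spinor_decomposition\<close>). Write also \<open>v = u + y\<close> with \<open>u \<in> N\<close> and
  \<open>y \<in> Nbar\<close>. The commutator \<open>[u, K] = -4 K u\<close> turns the component \<open>\<langle>\<psi>0 a v \<psi>\<rangle> = 0\<close>, \<open>a \<in> N\<close>, of
  \<open>v \<psi> = 0\<close> into \<open>y = - K u / (2 f)\<close>. Contracting the quadratic relation with \<open>b \<in> Nbar\<close> gives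
  \<open>2 s u\<cdot>b = 1/\<surd>2 (4 f w\<cdot>b + 1/64 (K \<psi>0 b K \<psi>0))\<close>, which determines \<open>w\<close> (\<open>plucker_solution\<close>); the last
  term is proportional to the contraction of \<open>\<Omega>bar\<close> with \<open>b\<close>, \<open>K\<close> and \<open>K\<close> (\<open>cdot_Omega_KK\<close>).

  All other components of the relations then hold (\<open>solution_plucker\<close>) because of two facts about
  the vector \<open>O = \<Omega>bar K K\<close>: it represents the square of \<open>K\<close>, namely \<open>K K \<psi>0 = 2 \<surd>2 O \<psi>bar\<close>
  (\<open>tensor_tensor_vacuum\<close>), and it is orthogonal to \<open>K a\<close> for \<open>a \<in> N\<close>, since \<open>(K a) K K \<psi>0\<close> is
  proportional to \<open>a K K K \<psi>0\<close>, and \<open>a\<close> annihilates the \<open>\<psi>0\<close> on the left of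
  \<open>(\<psi>0 a K K K \<psi>0)\<close> (\<open>cdot_tensor_vec_Omega\<close>).
\<close>

section \<open>Components of the gamma matrices\<close>

lemma UNIV_10: "(UNIV :: 10 set) = {1, 2, 3, 4, 5, 6, 7, 8, 9, 10}"
proof -
  have "card {1, 2, 3, 4, 5, 6, 7, 8, 9, 10 :: 10} = CARD(10)" by simp
  thus ?thesis by (intro card_subset_eq[symmetric]) auto
qed

lemma sum_10: "(\<Sum>i\<in>(UNIV :: 10 set). f i)
    = f 1 + f 2 + f 3 + f 4 + f 5 + f 6 + f 7 + f 8 + f 9 + (f 10 :: 'a :: comm_monoid_add)"
  unfolding UNIV_10 by (simp add: add.assoc)

lemma forall_10: "(\<forall>i :: 10. P i)
    \<longleftrightarrow> P 1 \<and> P 2 \<and> P 3 \<and> P 4 \<and> P 5 \<and> P 6 \<and> P 7 \<and> P 8 \<and> P 9 \<and> P 10"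
proof -
  have "(\<forall>i :: 10. P i) \<longleftrightarrow> (\<forall>i \<in> {1, 2, 3, 4, 5, 6, 7, 8, 9, 10 :: 10}. P i)"
    using UNIV_10 by blast
  thus ?thesis by simp
qed

definition bit_sign :: "2 \<Rightarrow> complex" where
  "bit_sign a = (if a = 1 then 1 else - 1)"

lemma bit_flip_flip [simp]: "(a :: 2) + 1 + 1 = a" "(a :: 2) + 2 = a"
  using exhaust_2[of a] by auto

lemma bit_sign_flip [simp]: "bit_sign (a + 1) = - bit_sign a"
  using exhaust_2[of a] by (auto simp: bit_sign_def)

lemma bit_sign_square [simp]: "bit_sign a * bit_sign a = 1" "bit_sign a * (bit_sign a * x) = x"
  by (auto simp: bit_sign_def)

lemma cnj_bit_sign [simp]: "cnj (bit_sign a) = bit_sign a"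
  by (simp add: bit_sign_def)

text \<open>
  Pauli matrices and their Kronecker products have one nonzero entry in each row, so they are
  recorded as an index map with a coefficient: the action on a spinor then needs no sums.
\<close>
definition monomial :: "complex ^ 'a ^ 'a \<Rightarrow> ('a \<Rightarrow> 'a) \<Rightarrow> ('a \<Rightarrow> complex) \<Rightarrow> bool" where
  "monomial A \<pi> c \<longleftrightarrow> (\<forall>a b. A $ a $ b = (if b = \<pi> a then c a else 0))"

lemma monomial_mat_1: "monomial (mat 1) (\<lambda>a. a) (\<lambda>a. 1)"
  by (auto simp: monomial_def mat_def)

lemma monomial_pauli:
  "monomial pauli1 (\<lambda>a. a + 1) (\<lambda>a. 1)"
  "monomial pauli2 (\<lambda>a. a + 1) (\<lambda>a. - \<i> * bit_sign a)"
  "monomial pauli3 (\<lambda>a. a) bit_sign"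
  by (auto simp: monomial_def pauli1_def pauli2_def pauli3_def bit_sign_def forall_2)

lemma monomial_kron:
  "monomial A \<pi> c \<Longrightarrow> monomial B \<rho> d \<Longrightarrow>
    monomial (A \<otimes> B) (\<lambda>(a, b). (\<pi> a, \<rho> b)) (\<lambda>(a, b). c a * d b)"
  by (auto simp: monomial_def kron_def split: prod.splits)

lemma monomial_mult_vec:
  "monomial A \<pi> c \<Longrightarrow> (A *v \<phi>) $ a = c a * \<phi> $ \<pi> a"
  by (simp add: monomial_def matrix_vector_mult_def if_distrib[of "\<lambda>x. x * _"] cong: if_cong)

lemma kron5_vec:
  assumes "monomial A \<pi> p" "monomial B \<rho> q" "monomial C \<sigma> r" "monomial D \<tau> s" "monomial E \<upsilon> t"
  shows "((A \<otimes> B \<otimes> C \<otimes> D \<otimes> E) *v \<phi>) $ (a, b, c, d, e)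
    = p a * q b * r c * s d * t e * \<phi> $ (\<pi> a, \<rho> b, \<sigma> c, \<tau> d, \<upsilon> e)"
  by (subst monomial_mult_vec[OF monomial_kron[OF assms(1) monomial_kron[OF assms(2)
        monomial_kron[OF assms(3) monomial_kron[OF assms(4,5)]]]]]) (simp add: mult.assoc)

lemma gamma_kron:
  "gamma 1 = pauli1 \<otimes> mat 1 \<otimes> mat 1 \<otimes> mat 1 \<otimes> mat 1"
  "gamma 2 = pauli2 \<otimes> mat 1 \<otimes> mat 1 \<otimes> mat 1 \<otimes> mat 1"
  "gamma 3 = pauli3 \<otimes> pauli1 \<otimes> mat 1 \<otimes> mat 1 \<otimes> mat 1"
  "gamma 4 = pauli3 \<otimes> pauli2 \<otimes> mat 1 \<otimes> mat 1 \<otimes> mat 1"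
  "gamma 5 = pauli3 \<otimes> pauli3 \<otimes> pauli1 \<otimes> mat 1 \<otimes> mat 1"
  "gamma 6 = pauli3 \<otimes> pauli3 \<otimes> pauli2 \<otimes> mat 1 \<otimes> mat 1"
  "gamma 7 = pauli3 \<otimes> pauli3 \<otimes> pauli3 \<otimes> pauli1 \<otimes> mat 1"
  "gamma 8 = pauli3 \<otimes> pauli3 \<otimes> pauli3 \<otimes> pauli2 \<otimes> mat 1"
  "gamma 9 = pauli3 \<otimes> pauli3 \<otimes> pauli3 \<otimes> pauli3 \<otimes> pauli1"
  "gamma 10 = pauli3 \<otimes> pauli3 \<otimes> pauli3 \<otimes> pauli3 \<otimes> pauli2"
  unfolding gamma_def by (simp_all add: vector_def)

lemma gamma_vec:
  "(gamma 1 *v \<phi>) $ (a, b, c, d, e) = \<phi> $ (a + 1, b, c, d, e)"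
  "(gamma 2 *v \<phi>) $ (a, b, c, d, e) = - \<i> * bit_sign a * \<phi> $ (a + 1, b, c, d, e)"
  "(gamma 3 *v \<phi>) $ (a, b, c, d, e) = bit_sign a * \<phi> $ (a, b + 1, c, d, e)"
  "(gamma 4 *v \<phi>) $ (a, b, c, d, e) = - \<i> * bit_sign a * bit_sign b * \<phi> $ (a, b + 1, c, d, e)"
  "(gamma 5 *v \<phi>) $ (a, b, c, d, e) = bit_sign a * bit_sign b * \<phi> $ (a, b, c + 1, d, e)"
  "(gamma 6 *v \<phi>) $ (a, b, c, d, e)
    = - \<i> * bit_sign a * bit_sign b * bit_sign c * \<phi> $ (a, b, c + 1, d, e)"
  "(gamma 7 *v \<phi>) $ (a, b, c, d, e)
    = bit_sign a * bit_sign b * bit_sign c * \<phi> $ (a, b, c, d + 1, e)"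
  "(gamma 8 *v \<phi>) $ (a, b, c, d, e)
    = - \<i> * bit_sign a * bit_sign b * bit_sign c * bit_sign d * \<phi> $ (a, b, c, d + 1, e)"
  "(gamma 9 *v \<phi>) $ (a, b, c, d, e)
    = bit_sign a * bit_sign b * bit_sign c * bit_sign d * \<phi> $ (a, b, c, d, e + 1)"
  "(gamma 10 *v \<phi>) $ (a, b, c, d, e)
    = - \<i> * bit_sign a * bit_sign b * bit_sign c * bit_sign d * bit_sign e * \<phi> $ (a, b, c, d, e + 1)"
  unfolding gamma_kron
  by (subst kron5_vec; (rule monomial_mat_1 monomial_pauli)?; simp)+

lemma gamma_anticommute:
  "gamma i *v (gamma j *v \<phi>) + gamma j *v (gamma i *v \<phi>) = (if i = j then 2 else 0) *s \<phi>"
proof -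
  have "\<forall>i j. gamma i *v (gamma j *v \<phi>) + gamma j *v (gamma i *v \<phi>) = (if i = j then 2 else 0) *s \<phi>"
    unfolding forall_10 by (simp add: vec_eq_iff gamma_vec mult_ac)
  thus ?thesis by blast
qed

section \<open>Hermitian form, charge conjugation and chirality\<close>

definition hform :: "spinor \<Rightarrow> spinor \<Rightarrow> complex" where
  "hform \<phi> \<psi> = (\<Sum>a\<in>UNIV. cnj (\<phi> $ a) * \<psi> $ a)"

text \<open>
  The antilinear involution \<open>\<phi> \<mapsto> C \<phi>\<^sup>*\<close> commutes with all gamma matrices. It turns the bilinear
  form into the Hermitian one (\<open>bform_eq_hform\<close> below), so that one set of rules serves both.
\<close>
definition majorana :: "spinor \<Rightarrow> spinor" where
  "majorana \<phi> = charge_conj *v spinor_cnj \<phi>"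

definition bform :: "spinor \<Rightarrow> spinor \<Rightarrow> complex" where
  "bform \<phi> \<psi> = bil \<phi> (mat 1) \<psi>"

lemma herm_eq_hform: "herm \<phi> A \<psi> = hform \<phi> (A *v \<psi>)"
  by (simp add: herm_def hform_def)

lemma bil_eq_bform: "bil \<phi> A \<psi> = bform \<phi> (A *v \<psi>)"
  by (simp add: bform_def bil_def matrix_vector_mul_assoc[symmetric])

lemma gamma_prod_vec:
  "gamma_prod [] *v \<phi> = \<phi>" "gamma_prod (i # is) *v \<phi> = gamma i *v (gamma_prod is *v \<phi>)"
  by (simp_all add: gamma_prod_def matrix_vector_mul_assoc[symmetric])

lemma charge_conj_vec:
  "(charge_conj *v \<phi>) $ (a, b, c, d, e)
    = bit_sign b * bit_sign d * \<phi> $ (a + 1, b + 1, c + 1, d + 1, e + 1)"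
  by (simp add: charge_conj_def gamma_prod_vec gamma_vec mult_ac)

lemma majorana_vec:
  "majorana \<phi> $ (a, b, c, d, e) = bit_sign b * bit_sign d * cnj (\<phi> $ (a + 1, b + 1, c + 1, d + 1, e + 1))"
  by (simp add: majorana_def charge_conj_vec spinor_cnj_def)

lemma majorana_majorana [simp]: "majorana (majorana \<phi>) = \<phi>"
  by (simp add: vec_eq_iff majorana_vec mult_ac)

lemma majorana_gamma: "majorana (gamma i *v \<phi>) = gamma i *v majorana \<phi>"
proof -
  have "\<forall>i. majorana (gamma i *v \<phi>) = gamma i *v majorana \<phi>"
    unfolding forall_10 by (simp add: vec_eq_iff majorana_vec gamma_vec mult_ac)
  thus ?thesis by blast
qed

text \<open>
  The eigenvalue of \<open>\<sigma>3 \<otimes> \<sigma>3 \<otimes> \<sigma>3 \<otimes> \<sigma>3 \<otimes> \<sigma>3\<close>, to which the volume element is proportional.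
\<close>
definition chirality :: "spin_index \<Rightarrow> complex" where
  "chirality = (\<lambda>(a, b, c, d, e). bit_sign a * bit_sign b * bit_sign c * bit_sign d * bit_sign e)"

lemma volume_vec:
  "gamma_prod [1, 2, 3, 4, 5, 6, 7, 8, 9, 10] *v \<phi> = (\<chi> x. \<i> * chirality x * \<phi> $ x)"
  by (simp add: vec_eq_iff gamma_prod_vec gamma_vec chirality_def mult_ac)

lemma Delta_plus_iff: "\<phi> \<in> Delta_plus \<longleftrightarrow> (\<forall>x. chirality x * \<phi> $ x = \<phi> $ x)"
  unfolding Delta_plus_def mem_Collect_eq volume_vec by (simp add: vec_eq_iff eval_nat_numeral mult_ac)

lemma sum_flip_index:
  "(\<Sum>x\<in>(UNIV :: spin_index set). f x)
    = (\<Sum>x\<in>UNIV. (case x of (a, b, c, d, e) \<Rightarrow> f (a + 1, b + 1, c + 1, d + 1, e + 1)))"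
  by (rule sum.reindex_bij_witness[where
        i = "\<lambda>(a, b, c, d, e). (a + 1, b + 1, c + 1, d + 1, e + 1)" and
        j = "\<lambda>(a, b, c, d, e). (a + 1, b + 1, c + 1, d + 1, e + 1)"]) auto

lemma bform_eq_hform: "bform \<phi> \<psi> = hform (majorana \<phi>) \<psi>"
  unfolding bform_def bil_def hform_def
  by (subst sum_flip_index, rule sum.cong) (auto simp: charge_conj_vec majorana_vec mult_ac)

lemma hform_majorana_majorana: "hform (majorana \<phi>) (majorana \<psi>) = hform \<psi> \<phi>"
  unfolding hform_def
  by (subst (2) sum_flip_index, rule sum.cong) (auto simp: majorana_vec mult_ac)

definition hermitian :: "complex ^ 'a ^ 'a \<Rightarrow> bool" where
  "hermitian A \<longleftrightarrow> (\<forall>a b. cnj (A $ a $ b) = A $ b $ a)"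

lemma hermitian_kron: "hermitian A \<Longrightarrow> hermitian B \<Longrightarrow> hermitian (A \<otimes> B)"
  by (simp add: hermitian_def kron_def)

lemma hermitian_pauli: "hermitian (mat 1)" "hermitian pauli1" "hermitian pauli2" "hermitian pauli3"
  by (auto simp: hermitian_def mat_def pauli1_def pauli2_def pauli3_def forall_2)

lemma hermitian_gamma: "hermitian (gamma i)"
proof -
  have "\<forall>i. hermitian (gamma i)"
    unfolding forall_10 gamma_kron by (intro conjI hermitian_kron hermitian_pauli)
  thus ?thesis by blast
qed

lemma hform_hermitian:
  assumes "hermitian A"
  shows "hform \<phi> (A *v \<psi>) = hform (A *v \<phi>) \<psi>"
proof -
  have A: "cnj (A $ a $ b) = A $ b $ a" for a b
    using assms unfolding hermitian_def by blast
  have "hform \<phi> (A *v \<psi>) = (\<Sum>a\<in>UNIV. \<Sum>b\<in>UNIV. cnj (\<phi> $ a) * (A $ a $ b * \<psi> $ b))"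
    by (simp add: hform_def matrix_vector_mult_def sum_distrib_left)
  also have "\<dots> = (\<Sum>b\<in>UNIV. \<Sum>a\<in>UNIV. cnj (\<phi> $ a) * (A $ a $ b * \<psi> $ b))"
    by (rule sum.swap)
  also have "\<dots> = hform (A *v \<phi>) \<psi>"
    by (simp add: A hform_def matrix_vector_mult_def sum_distrib_left sum_distrib_right mult_ac)
  finally show ?thesis .
qed

lemma sum_spin_index:
  "(\<Sum>x\<in>(UNIV :: spin_index set). f x) = (\<Sum>a\<in>UNIV. \<Sum>b\<in>UNIV. \<Sum>c\<in>UNIV. \<Sum>d\<in>UNIV. \<Sum>e\<in>UNIV. f (a, b, c, d, e))"
  by (simp add: UNIV_Times_UNIV[symmetric] sum.cartesian_product' del: UNIV_Times_UNIV)

section \<open>The null vector of a chiral spinor\<close>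

text \<open>
  A chiral spinor has 16 components: a number, an antisymmetric 5 by 5 matrix and a vector. In these
  terms the norm of the vector is a multiple of a sum of five products, which vanishes by the
  expansion rules of Pfaffians.
\<close>
lemma chiral_vector_null:
  assumes "\<psi> \<in> Delta_plus"
  shows "(\<Sum>i\<in>UNIV. (bform \<psi> (gamma i *v \<psi>))\<^sup>2) = 0"
proof -
  have z: "\<psi> $ x = 0" if "chirality x = - 1" for x
    using assms[unfolded Delta_plus_iff, rule_format, of x] that by simp
  have "\<psi> $ (1,1,1,1,2) = 0" "\<psi> $ (1,1,1,2,1) = 0" "\<psi> $ (1,1,2,1,1) = 0" "\<psi> $ (1,2,1,1,1) = 0"
    "\<psi> $ (2,1,1,1,1) = 0" "\<psi> $ (1,1,2,2,2) = 0" "\<psi> $ (1,2,1,2,2) = 0" "\<psi> $ (1,2,2,1,2) = 0"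
    "\<psi> $ (1,2,2,2,1) = 0" "\<psi> $ (2,1,1,2,2) = 0" "\<psi> $ (2,1,2,1,2) = 0" "\<psi> $ (2,1,2,2,1) = 0"
    "\<psi> $ (2,2,1,1,2) = 0" "\<psi> $ (2,2,1,2,1) = 0" "\<psi> $ (2,2,2,1,1) = 0" "\<psi> $ (2,2,2,2,2) = 0"
    by (rule z, simp add: chirality_def bit_sign_def)+
  note z = this
  have [simp]: "bit_sign 1 = 1" "bit_sign 2 = - 1" "(3 :: 2) = 1" "(4 :: 2) = 2"
    by (simp_all add: bit_sign_def)
  have "bform \<psi> \<phi> = (\<Sum>(a, b, c, d, e)\<in>UNIV. \<psi> $ (a, b, c, d, e) *
      (bit_sign b * bit_sign d * \<phi> $ (a + 1, b + 1, c + 1, d + 1, e + 1)))" for \<phi>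
    by (auto simp: bform_def bil_def charge_conj_vec intro!: sum.cong)
  hence expand: "bform \<psi> \<phi> = (\<Sum>a\<in>{1, 2}. \<Sum>b\<in>{1, 2}. \<Sum>c\<in>{1, 2}. \<Sum>d\<in>{1, 2}. \<Sum>e\<in>{1, 2}.
      \<psi> $ (a, b, c, d, e) *
      (bit_sign b * bit_sign d * \<phi> $ (a + 1, b + 1, c + 1, d + 1, e + 1)))" for \<phi>
    unfolding sum_spin_index UNIV_2 by simp
  note expand = expand[simplified, simplified z, simplified]
  \<comment> \<open>In Fock notation: the vacuum amplitude \<open>f\<close>, the amplitudes of the states with two
    occupied levels, and those of the states with one empty level.\<close>
  define f where "f = \<psi> $ (1, 1, 1, 1, 1)"
  define k45 where "k45 = \<psi> $ (1, 1, 1, 2, 2)"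
  define k35 where "k35 = \<psi> $ (1, 1, 2, 1, 2)"
  define k34 where "k34 = \<psi> $ (1, 1, 2, 2, 1)"
  define k25 where "k25 = \<psi> $ (1, 2, 1, 1, 2)"
  define k24 where "k24 = \<psi> $ (1, 2, 1, 2, 1)"
  define k23 where "k23 = \<psi> $ (1, 2, 2, 1, 1)"
  define w1 where "w1 = \<psi> $ (1, 2, 2, 2, 2)"
  define k15 where "k15 = \<psi> $ (2, 1, 1, 1, 2)"
  define k14 where "k14 = \<psi> $ (2, 1, 1, 2, 1)"
  define k13 where "k13 = \<psi> $ (2, 1, 2, 1, 1)"
  define w2 where "w2 = \<psi> $ (2, 1, 2, 2, 2)"
  define k12 where "k12 = \<psi> $ (2, 2, 1, 1, 1)"
  define w3 where "w3 = \<psi> $ (2, 2, 1, 2, 2)"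
  define w4 where "w4 = \<psi> $ (2, 2, 2, 1, 2)"
  define w5 where "w5 = \<psi> $ (2, 2, 2, 2, 1)"
  note comps = f_def[symmetric] k45_def[symmetric] k35_def[symmetric] k34_def[symmetric]
    k25_def[symmetric] k24_def[symmetric] k23_def[symmetric] k15_def[symmetric] k14_def[symmetric]
    k13_def[symmetric] k12_def[symmetric] w1_def[symmetric] w2_def[symmetric] w3_def[symmetric]
    w4_def[symmetric] w5_def[symmetric]
  \<comment> \<open>The components of the vector along five pairs of conjugate null directions: up to sign
    \<open>f w\<close> minus the Pfaffians of \<open>k\<close>, and the matrix \<open>k\<close> applied to \<open>w\<close>. Their pairing vanishes
    because \<open>k\<close> is antisymmetric and annihilates the vector of its own Pfaffians.\<close>
  define X1 where "X1 = f * w1 - k23 * k45 + k24 * k35 - k25 * k34"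
  define Y1 where "Y1 = k13 * w3 + k15 * w5 - k12 * w2 - k14 * w4"
  define X2 where "X2 = k13 * k45 - k14 * k35 + k15 * k34 - f * w2"
  define Y2 where "Y2 = k25 * w5 + k23 * w3 - k24 * w4 - k12 * w1"
  define X3 where "X3 = f * w3 - k12 * k45 + k14 * k25 - k15 * k24"
  define Y3 where "Y3 = k35 * w5 - k34 * w4 + k23 * w2 - k13 * w1"
  define X4 where "X4 = k12 * k35 + k15 * k23 - k13 * k25 - f * w4"
  define Y4 where "Y4 = k45 * w5 - k34 * w3 + k24 * w2 - k14 * w1"
  define X5 where "X5 = f * w5 - k12 * k34 + k13 * k24 - k14 * k23"
  define Y5 where "Y5 = k45 * w4 - k35 * w3 + k25 * w2 - k15 * w1"
  note XY = X1_def Y1_def X2_def Y2_def X3_def Y3_def X4_def Y4_def X5_def Y5_def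
  have q1: "bform \<psi> (gamma 1 *v \<psi>) = 2 * (X1 + Y1)"
    unfolding expand gamma_vec by (simp add: comps, simp add: XY algebra_simps)
  have q2: "bform \<psi> (gamma 2 *v \<psi>) = 2 * \<i> * (X1 - Y1)"
    unfolding expand gamma_vec by (simp add: comps, simp add: XY algebra_simps)
  have q3: "bform \<psi> (gamma 3 *v \<psi>) = 2 * (X2 + Y2)"
    unfolding expand gamma_vec by (simp add: comps, simp add: XY algebra_simps)
  have q4: "bform \<psi> (gamma 4 *v \<psi>) = 2 * \<i> * (X2 - Y2)"
    unfolding expand gamma_vec by (simp add: comps, simp add: XY algebra_simps)
  have q5: "bform \<psi> (gamma 5 *v \<psi>) = 2 * (X3 + Y3)"
    unfolding expand gamma_vec by (simp add: comps, simp add: XY algebra_simps)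
  have q6: "bform \<psi> (gamma 6 *v \<psi>) = 2 * \<i> * (X3 - Y3)"
    unfolding expand gamma_vec by (simp add: comps, simp add: XY algebra_simps)
  have q7: "bform \<psi> (gamma 7 *v \<psi>) = 2 * (X4 + Y4)"
    unfolding expand gamma_vec by (simp add: comps, simp add: XY algebra_simps)
  have q8: "bform \<psi> (gamma 8 *v \<psi>) = 2 * \<i> * (X4 - Y4)"
    unfolding expand gamma_vec by (simp add: comps, simp add: XY algebra_simps)
  have q9: "bform \<psi> (gamma 9 *v \<psi>) = 2 * (X5 + Y5)"
    unfolding expand gamma_vec by (simp add: comps, simp add: XY algebra_simps)
  have q10: "bform \<psi> (gamma 10 *v \<psi>) = 2 * \<i> * (X5 - Y5)"
    unfolding expand gamma_vec by (simp add: comps, simp add: XY algebra_simps)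
  have null: "X1 * Y1 + X2 * Y2 + X3 * Y3 + X4 * Y4 + X5 * Y5 = 0"
    unfolding XY by (simp add: algebra_simps)
  have square: "(2 * (x + y))\<^sup>2 + (2 * \<i> * (x - y))\<^sup>2 = 16 * (x * y)" for x y
    by (simp add: power2_eq_square algebra_simps)
  have regroup: "a1 + b1 + a2 + b2 + a3 + b3 + a4 + b4 + a5 + b5
      = (a1 + b1) + (a2 + b2) + (a3 + b3) + (a4 + b4) + (a5 + b5)"
    for a1 a2 a3 a4 a5 b1 b2 b3 b4 b5 :: complex
    by (simp only: add.assoc)
  show ?thesis
    unfolding sum_10 q1 q2 q3 q4 q5 q6 q7 q8 q9 q10
    by (subst regroup) (simp only: square distrib_left[symmetric] null mult_zero_right)
qed

section \<open>Clifford multiplication as an operation on spinors\<close>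

definition act :: "cvec \<Rightarrow> spinor \<Rightarrow> spinor" (infixr "\<odot>" 75) where
  "v \<odot> \<phi> = clifford v *v \<phi>"

definition vcnj :: "cvec \<Rightarrow> cvec" where
  "vcnj v = (\<chi> i. cnj (v $ i))"

lemma matrix_vector_sum_left: "(\<Sum>i\<in>I. A i) *v \<phi> = (\<Sum>i\<in>I. A i *v \<phi>)"
  by (induction I rule: infinite_finite_induct) (simp_all add: matrix_vector_mult_add_rdistrib)

lemma matrix_vector_sum_right: "A *v (\<Sum>i\<in>I. \<phi> i) = (\<Sum>i\<in>I. A *v \<phi> i)"
  by (induction I rule: infinite_finite_induct) (simp_all add: matrix_vector_right_distrib)

lemma matrix_vector_scale: "A *v (c *s \<phi>) = c *s (A *v \<phi>)" for A :: "complex ^ 'n ^ 'm"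
  by (simp add: vec_eq_iff matrix_vector_mult_def sum_distrib_left mult_ac)

lemma matrix_vector_neg: "A *v (- \<phi>) = - (A *v \<phi>)" for A :: "complex ^ 'n ^ 'm"
  by (simp add: vec_eq_iff matrix_vector_mult_def sum_negf)

lemma mat_scale: "mat c *v \<phi> = c *s \<phi>" for c :: complex
proof -
  have "(if i = j then c else 0) * x = (if j = i then c * x else 0)" for i j :: 'a and x
    by simp
  thus ?thesis by (simp add: vec_eq_iff matrix_vector_mult_def mat_def)
qed

lemma act_expand: "v \<odot> \<phi> = (\<Sum>i\<in>UNIV. v $ i *s (gamma i *v \<phi>))"
  by (simp add: act_def clifford_def matrix_vector_sum_left matrix_vector_mul_assoc[symmetric] mat_scale)

lemma act_left:
  "(v + w) \<odot> \<phi> = v \<odot> \<phi> + w \<odot> \<phi>" "(v - w) \<odot> \<phi> = v \<odot> \<phi> - w \<odot> \<phi>"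
  "(c *s v) \<odot> \<phi> = c *s (v \<odot> \<phi>)" "0 \<odot> \<phi> = 0" "(- v) \<odot> \<phi> = - (v \<odot> \<phi>)"
  by (simp_all add: act_expand vec_eq_iff sum.distrib sum_subtractf sum_negf sum_distrib_left algebra_simps)

lemma act_right:
  "v \<odot> (\<phi> + \<psi>) = v \<odot> \<phi> + v \<odot> \<psi>" "v \<odot> (\<phi> - \<psi>) = v \<odot> \<phi> - v \<odot> \<psi>"
  "v \<odot> (c *s \<phi>) = c *s (v \<odot> \<phi>)" "v \<odot> 0 = 0" "v \<odot> (- \<phi>) = - (v \<odot> \<phi>)"
  by (simp_all add: act_def matrix_vector_right_distrib matrix_vector_mult_diff_distrib matrix_vector_scale
      matrix_vector_neg)

lemma act_sum_left: "(\<Sum>i\<in>I. v i) \<odot> \<phi> = (\<Sum>i\<in>I. v i \<odot> \<phi>)"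
  by (induction I rule: infinite_finite_induct) (simp_all add: act_left)

lemma act_sum_right: "v \<odot> (\<Sum>i\<in>I. \<phi> i) = (\<Sum>i\<in>I. v \<odot> \<phi> i)"
  by (simp add: act_def matrix_vector_sum_right)

lemma act_axis: "axis i 1 \<odot> \<phi> = gamma i *v \<phi>"
proof -
  have "axis i 1 $ j *s \<psi> = (if j = i then \<psi> else 0)" for j :: 10 and \<psi> :: spinor
    by (simp add: axis_def)
  thus ?thesis by (simp add: act_expand)
qed

lemmas act_simps = act_left act_right

lemma cdot_simps:
  "cdot (v + w) x = cdot v x + cdot w x" "cdot x (v + w) = cdot x v + cdot x w"
  "cdot (v - w) x = cdot v x - cdot w x" "cdot x (v - w) = cdot x v - cdot x w"
  "cdot (c *s v) x = c * cdot v x" "cdot x (c *s v) = c * cdot x v"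
  "cdot (- v) x = - cdot v x" "cdot x (- v) = - cdot x v" "cdot 0 x = 0" "cdot x 0 = 0"
  by (simp_all add: cdot_def sum.distrib sum_subtractf sum_negf sum_distrib_left algebra_simps)

lemma cdot_commute: "cdot v w = cdot w v"
  by (simp add: cdot_def mult.commute)

lemma cdot_axis: "cdot (axis i 1) v = v $ i" "cdot v (axis i 1) = v $ i"
  by (simp_all add: cdot_def axis_def if_distrib[of "\<lambda>x. x * _"] if_distrib[of "\<lambda>x. _ * x"] cong: if_cong)

lemma cdot_vcnj_self: "cdot (vcnj v) v = 0 \<longleftrightarrow> v = 0"
proof -
  have "cdot (vcnj v) v = complex_of_real (\<Sum>i\<in>UNIV. (norm (v $ i))\<^sup>2)"
    unfolding of_real_sum
    by (simp add: cdot_def vcnj_def complex_norm_square mult.commute del: of_real_power)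
  thus ?thesis by (simp only: of_real_eq_0_iff) (simp add: sum_nonneg_eq_0_iff vec_eq_iff)
qed

lemma vcnj_simps [simp]:
  "vcnj (vcnj v) = v" "vcnj (v + w) = vcnj v + vcnj w" "vcnj (v - w) = vcnj v - vcnj w"
  "vcnj (c *s v) = cnj c *s vcnj v" "vcnj 0 = 0" "vcnj (- v) = - vcnj v"
  by (simp_all add: vcnj_def vec_eq_iff)

lemma clifford_relation: "v \<odot> w \<odot> \<phi> + w \<odot> v \<odot> \<phi> = (2 * cdot v w) *s \<phi>"
proof -
  have "v \<odot> w \<odot> \<phi> + w \<odot> v \<odot> \<phi>
      = (\<Sum>i\<in>UNIV. \<Sum>j\<in>UNIV. (v $ i * w $ j) *s (gamma i *v (gamma j *v \<phi>)))
      + (\<Sum>j\<in>UNIV. \<Sum>i\<in>UNIV. (v $ i * w $ j) *s (gamma j *v (gamma i *v \<phi>)))"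
    by (simp add: act_expand matrix_vector_sum_right matrix_vector_scale vec.scale_sum_right mult_ac)
  also have "\<dots> = (\<Sum>i\<in>UNIV. \<Sum>j\<in>UNIV. (v $ i * w $ j) *s
      (gamma i *v (gamma j *v \<phi>) + gamma j *v (gamma i *v \<phi>)))"
    by (subst (2) sum.swap) (simp add: sum.distrib[symmetric] vec.scale_right_distrib)
  also have "\<dots> = (\<Sum>i\<in>UNIV. \<Sum>j\<in>UNIV. if i = j then (2 * (v $ i * w $ i)) *s \<phi> else 0)"
    unfolding gamma_anticommute by (intro sum.cong refl) (auto simp: mult_ac)
  also have "\<dots> = (2 * cdot v w) *s \<phi>"
    by (simp add: cdot_def sum_distrib_left vec.scale_sum_left)
  finally show ?thesis .
qed

lemma act_swap: "v \<odot> w \<odot> \<phi> = (2 * cdot v w) *s \<phi> - w \<odot> v \<odot> \<phi>"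
  using clifford_relation[of v w \<phi>] by (simp add: algebra_simps)

lemma act_act_self: "v \<odot> v \<odot> \<phi> = cdot v v *s \<phi>"
  using clifford_relation[of v v \<phi>] by (simp add: vec_eq_iff)

lemma hform_simps:
  "hform \<phi> (\<psi> + \<eta>) = hform \<phi> \<psi> + hform \<phi> \<eta>" "hform \<phi> (\<psi> - \<eta>) = hform \<phi> \<psi> - hform \<phi> \<eta>"
  "hform \<phi> (c *s \<psi>) = c * hform \<phi> \<psi>" "hform \<phi> 0 = 0" "hform \<phi> (- \<psi>) = - hform \<phi> \<psi>"
  "hform (\<psi> + \<eta>) \<phi> = hform \<psi> \<phi> + hform \<eta> \<phi>" "hform (\<psi> - \<eta>) \<phi> = hform \<psi> \<phi> - hform \<eta> \<phi>"
  "hform (c *s \<psi>) \<phi> = cnj c * hform \<psi> \<phi>" "hform 0 \<phi> = 0" "hform (- \<psi>) \<phi> = - hform \<psi> \<phi>"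
  by (simp_all add: hform_def sum.distrib sum_subtractf sum_negf sum_distrib_left algebra_simps)

lemma hform_cnj: "cnj (hform \<phi> \<psi>) = hform \<psi> \<phi>"
  by (simp add: hform_def mult.commute)

lemma hform_self_eq_0: "hform \<phi> \<phi> = 0 \<longleftrightarrow> \<phi> = 0"
proof -
  have "hform \<phi> \<phi> = complex_of_real (\<Sum>i\<in>UNIV. (norm (\<phi> $ i))\<^sup>2)"
    unfolding hform_def of_real_sum by (simp add: complex_norm_square mult.commute del: of_real_power)
  thus ?thesis by (simp only: of_real_eq_0_iff) (simp add: sum_nonneg_eq_0_iff vec_eq_iff)
qed

lemma hform_sum_right: "hform \<phi> (\<Sum>i\<in>I. \<psi> i) = (\<Sum>i\<in>I. hform \<phi> (\<psi> i))"
  by (induction I rule: infinite_finite_induct) (simp_all add: hform_simps)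

lemma hform_sum_left: "hform (\<Sum>i\<in>I. \<psi> i) \<phi> = (\<Sum>i\<in>I. hform (\<psi> i) \<phi>)"
  by (induction I rule: infinite_finite_induct) (simp_all add: hform_simps)

lemma hform_act: "hform \<phi> (v \<odot> \<psi>) = hform (vcnj v \<odot> \<phi>) \<psi>"
  by (simp add: act_expand hform_sum_right hform_sum_left hform_simps hform_hermitian[OF hermitian_gamma] vcnj_def)

lemma majorana_simps:
  "majorana (\<phi> + \<psi>) = majorana \<phi> + majorana \<psi>" "majorana (c *s \<phi>) = cnj c *s majorana \<phi>" "majorana 0 = 0"
  by (simp_all add: vec_eq_iff majorana_vec algebra_simps)

lemma majorana_act: "majorana (v \<odot> \<phi>) = vcnj v \<odot> majorana \<phi>"
proof -
  have "majorana (\<Sum>i\<in>I. f i) = (\<Sum>i\<in>I. majorana (f i))" for I :: "10 set" and f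
    by (induction I rule: infinite_finite_induct) (simp_all add: majorana_simps)
  thus ?thesis by (simp add: act_expand majorana_simps majorana_gamma vcnj_def)
qed

lemma bform_simps:
  "bform \<phi> (\<psi> + \<eta>) = bform \<phi> \<psi> + bform \<phi> \<eta>" "bform \<phi> (\<psi> - \<eta>) = bform \<phi> \<psi> - bform \<phi> \<eta>"
  "bform \<phi> (c *s \<psi>) = c * bform \<phi> \<psi>" "bform \<phi> 0 = 0" "bform \<phi> (- \<psi>) = - bform \<phi> \<psi>"
  by (simp_all add: bform_eq_hform hform_simps)

lemma bform_commute: "bform \<phi> \<psi> = bform \<psi> \<phi>"
  using hform_majorana_majorana[of \<phi> "majorana \<psi>"] by (simp add: bform_eq_hform)

lemma bform_simps_left:
  "bform (\<psi> + \<eta>) \<phi> = bform \<psi> \<phi> + bform \<eta> \<phi>" "bform (\<psi> - \<eta>) \<phi> = bform \<psi> \<phi> - bform \<eta> \<phi>"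
  "bform (c *s \<psi>) \<phi> = c * bform \<psi> \<phi>" "bform 0 \<phi> = 0" "bform (- \<psi>) \<phi> = - bform \<psi> \<phi>"
  by (simp_all add: bform_commute[of _ \<phi>] bform_simps)

lemma bform_act: "bform \<phi> (v \<odot> \<psi>) = bform (v \<odot> \<phi>) \<psi>"
  by (simp add: bform_eq_hform hform_act majorana_act)

lemma bform_sum_right: "bform \<phi> (\<Sum>i\<in>I. \<psi> i) = (\<Sum>i\<in>I. bform \<phi> (\<psi> i))"
  by (simp add: bform_eq_hform hform_sum_right)

lemma bform_sum_left: "bform (\<Sum>i\<in>I. \<psi> i) \<phi> = (\<Sum>i\<in>I. bform (\<psi> i) \<phi>)"
  by (simp add: bform_commute[of _ \<phi>] bform_sum_right)

section \<open>The two chiralities\<close>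

definition Delta_minus :: "spinor set" where
  "Delta_minus = {\<phi>. \<forall>x. chirality x * \<phi> $ x = - \<phi> $ x}"

lemma Delta_plus_subspace: "vec.subspace Delta_plus"
proof (rule vec.subspaceI)
  show "\<phi> + \<psi> \<in> Delta_plus" if "\<phi> \<in> Delta_plus" "\<psi> \<in> Delta_plus" for \<phi> \<psi>
    using that by (simp only: Delta_plus_iff vector_add_component distrib_left simp_thms)
  show "c *s \<phi> \<in> Delta_plus" if "\<phi> \<in> Delta_plus" for c \<phi>
    using that by (simp only: Delta_plus_iff vector_smult_component mult.left_commute simp_thms)
qed (simp add: Delta_plus_iff)

lemma Delta_minus_subspace: "vec.subspace Delta_minus"
proof (rule vec.subspaceI)
  show "\<phi> + \<psi> \<in> Delta_minus" if "\<phi> \<in> Delta_minus" "\<psi> \<in> Delta_minus" for \<phi> \<psi>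
    using that by (simp only: Delta_minus_def mem_Collect_eq vector_add_component distrib_left minus_add_distrib simp_thms)
  show "c *s \<phi> \<in> Delta_minus" if "\<phi> \<in> Delta_minus" for c \<phi>
    using that by (simp only: Delta_minus_def mem_Collect_eq vector_smult_component mult.left_commute mult_minus_right simp_thms)
qed (simp add: Delta_minus_def)

lemma chirality_gamma: "chirality x * (gamma i *v \<phi>) $ x = - (gamma i *v (\<chi> y. chirality y * \<phi> $ y)) $ x"
proof -
  have "\<forall>i. \<forall>x. chirality x * (gamma i *v \<phi>) $ x = - (gamma i *v (\<chi> y. chirality y * \<phi> $ y)) $ x"
    unfolding forall_10 by (simp add: gamma_vec chirality_def mult_ac)
  thus ?thesis by blast
qed

lemma act_Delta_plus: "\<phi> \<in> Delta_plus \<Longrightarrow> v \<odot> \<phi> \<in> Delta_minus"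
proof -
  assume "\<phi> \<in> Delta_plus"
  hence "(\<chi> y. chirality y * \<phi> $ y) = \<phi>" unfolding Delta_plus_iff vec_eq_iff by simp
  hence "gamma i *v \<phi> \<in> Delta_minus" for i
    unfolding Delta_minus_def using chirality_gamma[of _ i \<phi>] by simp
  thus ?thesis unfolding act_expand
    by (intro vec.subspace_sum vec.subspace_scale Delta_minus_subspace)
qed

lemma act_Delta_minus: "\<phi> \<in> Delta_minus \<Longrightarrow> v \<odot> \<phi> \<in> Delta_plus"
proof -
  assume "\<phi> \<in> Delta_minus"
  hence "(\<chi> y. chirality y * \<phi> $ y) = - \<phi>" unfolding Delta_minus_def vec_eq_iff by simp
  hence "gamma i *v \<phi> \<in> Delta_plus" for i
    unfolding Delta_plus_iff using chirality_gamma[of _ i \<phi>] by (simp add: matrix_vector_neg)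
  thus ?thesis unfolding act_expand
    by (intro vec.subspace_sum vec.subspace_scale Delta_plus_subspace)
qed

lemma majorana_Delta_plus: "\<phi> \<in> Delta_plus \<Longrightarrow> majorana \<phi> \<in> Delta_minus"
  and majorana_Delta_minus: "\<phi> \<in> Delta_minus \<Longrightarrow> majorana \<phi> \<in> Delta_plus"
proof -
  have c: "chirality (a, b, c, d, e) * majorana \<phi> $ (a, b, c, d, e) =
      - (bit_sign b * bit_sign d * cnj (chirality (a + 1, b + 1, c + 1, d + 1, e + 1) *
        \<phi> $ (a + 1, b + 1, c + 1, d + 1, e + 1)))" for a b c d e \<phi>
    by (simp add: majorana_vec chirality_def mult_ac)
  show "majorana \<phi> \<in> Delta_minus" if "\<phi> \<in> Delta_plus"
  proof -
    have "chirality x * \<phi> $ x = \<phi> $ x" for x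
      using that by (simp only: Delta_plus_iff)
    thus ?thesis
      by (simp only: Delta_minus_def mem_Collect_eq split_paired_All c) (simp add: majorana_vec)
  qed
  show "majorana \<phi> \<in> Delta_plus" if "\<phi> \<in> Delta_minus"
  proof -
    have "chirality x * \<phi> $ x = - \<phi> $ x" for x
      using that by (simp only: Delta_minus_def mem_Collect_eq)
    thus ?thesis
      by (simp only: Delta_plus_iff split_paired_All c) (simp add: majorana_vec)
  qed
qed

lemma dim_Delta_plus: "vec.dim Delta_plus = 16"
proof -
  let ?E = "{x. chirality x = 1}"
  have pm: "chirality x = 1 \<or> chirality x = - 1" for x
    by (auto simp: chirality_def bit_sign_def split: prod.splits)
  have D: "Delta_plus = {\<phi>. \<forall>x. x \<notin> ?E \<longrightarrow> \<phi> $ x = 0}"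
  proof -
    have "chirality x * y = y \<longleftrightarrow> (chirality x \<noteq> 1 \<longrightarrow> y = 0)" for x y
      using pm[of x] by auto
    thus ?thesis unfolding Delta_plus_iff set_eq_iff by simp
  qed
  have c: "card ?E = 16"
  proof -
    have "(\<Sum>a\<in>UNIV. bit_sign a) = 0"
      by (simp add: sum_2 bit_sign_def)
    hence "(\<Sum>x\<in>UNIV. chirality x) = 0"
      by (simp add: sum_spin_index chirality_def sum_distrib_left[symmetric])
    moreover have "(of_nat (card ?E) :: complex) = (\<Sum>x\<in>UNIV. if chirality x = 1 then 1 else 0)"
      by (simp add: sum.If_cases)
    moreover have "(if chirality x = 1 then 1 else 0 :: complex) = (1 + chirality x) / 2" for x
      using pm[of x] by auto
    ultimately have "(of_nat (card ?E) :: complex) = of_nat 16"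
      by (simp add: sum.distrib add_divide_distrib sum_divide_distrib[symmetric])
    thus ?thesis by (simp only: of_nat_eq_iff)
  qed
  show ?thesis unfolding D dim_substandard_cart by (rule c)
qed

section \<open>Bivectors acting on spinors\<close>

lemma matrix_vector_scaleR: "(r *\<^sub>R A) *v \<phi> = complex_of_real r *s (A *v \<phi>)"
  by (simp add: vec_eq_iff matrix_vector_mult_def sum_distrib_left) (simp add: scaleR_conv_of_real mult_ac)

lemma gamma_asym_pair: "gamma_asym [i, j] = (1 / 2) *\<^sub>R (gamma i ** gamma j - gamma j ** gamma i)"
proof -
  have two: "{..<Suc (Suc 0)} = {0, Suc 0}" by auto
  have perms: "{p. p permutes {0, Suc 0}} = {id, Transposition.transpose 0 (Suc 0)}"
    by (simp add: permutes_doubleton_iff set_eq_iff)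
  have "id \<noteq> Transposition.transpose 0 (Suc 0)"
    by (simp add: fun_eq_iff Transposition.transpose_def) auto
  hence "(\<Sum>p | p permutes {..<length [i, j]}. of_int (sign p) *\<^sub>R
      gamma_prod (map (\<lambda>k. [i, j] ! p k) [0..<length [i, j]]))
      = gamma i ** gamma j - gamma j ** gamma i"
    by (simp add: two perms sign_swap_id sign_id gamma_prod_def)
  thus ?thesis unfolding gamma_asym_def by simp
qed

definition skew :: "tensor2 \<Rightarrow> bool" where
  "skew K \<longleftrightarrow> (\<forall>i j. K $ (i, j) = - K $ (j, i))"

lemma skew_iff: "skew K \<Longrightarrow> K $ (i, j) = - K $ (j, i)"
  unfolding skew_def by blast

lemma skew_diag: "skew K \<Longrightarrow> K $ (i, i) = 0"
  using skew_iff[of K i i] by simp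

lemma skew_zero: "skew 0"
  by (simp add: skew_def)

lemma skew_add:
  assumes "skew K" "skew L"
  shows "skew (K + L)"
  unfolding skew_def
proof (intro allI)
  fix i j
  show "(K + L) $ (i, j) = - (K + L) $ (j, i)"
    unfolding vector_add_component skew_iff[OF assms(1), of i j] skew_iff[OF assms(2), of i j]
    by (rule minus_add_distrib[symmetric])
qed

lemma skew_scale:
  assumes "skew K"
  shows "skew (c *s K)"
  unfolding skew_def
proof (intro allI)
  fix i j
  show "(c *s K) $ (i, j) = - (c *s K) $ (j, i)"
    unfolding vector_smult_component skew_iff[OF assms, of i j] by (rule mult_minus_right)
qed

lemma tensor_spinor_gamma:
  assumes "skew K"
  shows "tensor_spinor K \<phi> = (\<Sum>i\<in>UNIV. \<Sum>j\<in>UNIV. K $ (i, j) *s (gamma i *v (gamma j *v \<phi>)))"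
proof -
  have "gamma_asym [i, j] *v \<phi> = gamma i *v (gamma j *v \<phi>) - (if i = j then 1 else 0) *s \<phi>" for i j
  proof -
    have "gamma_asym [i, j] *v \<phi> = (1 / 2) *s (gamma i *v (gamma j *v \<phi>) - gamma j *v (gamma i *v \<phi>))"
      unfolding gamma_asym_pair
      by (simp add: matrix_vector_scaleR matrix_vector_mult_diff_rdistrib matrix_vector_mul_assoc)
    also have "gamma j *v (gamma i *v \<phi>) = (if i = j then 2 else 0) *s \<phi> - gamma i *v (gamma j *v \<phi>)"
      using gamma_anticommute[of i j \<phi>] by (simp add: algebra_simps)
    finally show ?thesis by (cases "i = j") (simp_all add: vec_eq_iff field_simps)
  qed
  moreover have "K $ (i, j) *s ((if i = j then 1 else 0) *s \<phi>) = 0" for i j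
    by (cases "i = j") (simp_all add: skew_diag[OF assms])
  ultimately have "K $ (i, j) *s (gamma_asym [i, j] *v \<phi>) = K $ (i, j) *s (gamma i *v (gamma j *v \<phi>))" for i j
    by (simp only: vec.scale_right_diff_distrib diff_zero)
  thus ?thesis by (simp only: tensor_spinor_def)
qed

text \<open>
  With rows as vectors, a bivector acts by a sum of ten products of two Clifford
  multiplications, and the commutation rules below follow from the Clifford relation alone.
\<close>
definition tensor_row :: "tensor2 \<Rightarrow> 10 \<Rightarrow> cvec" where
  "tensor_row K i = (\<chi> j. K $ (i, j))"

lemma tensor_spinor_act:
  "skew K \<Longrightarrow> tensor_spinor K \<phi> = (\<Sum>i\<in>UNIV. axis i 1 \<odot> tensor_row K i \<odot> \<phi>)"
  unfolding act_axis act_expand[of "tensor_row K _"]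
  by (simp add: tensor_spinor_gamma tensor_row_def matrix_vector_sum_right matrix_vector_scale)

lemma tensor_spinor_add: "tensor_spinor (K + L) \<phi> = tensor_spinor K \<phi> + tensor_spinor L \<phi>"
  and tensor_spinor_scale: "tensor_spinor (c *s K) \<phi> = c *s tensor_spinor K \<phi>"
  and tensor_spinor_zero: "tensor_spinor 0 \<phi> = 0"
  by (simp_all add: tensor_spinor_def vec_eq_iff sum.distrib sum_distrib_left algebra_simps)

lemma tensor_spinor_diff: "tensor_spinor (K - L) \<phi> = tensor_spinor K \<phi> - tensor_spinor L \<phi>"
  and tensor_spinor_minus: "tensor_spinor (- K) \<phi> = - tensor_spinor K \<phi>"
  by (simp_all add: tensor_spinor_def vec_eq_iff sum_subtractf sum_negf algebra_simps)

lemma tensor_spinor_right: 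
  "tensor_spinor K (\<phi> + \<psi>) = tensor_spinor K \<phi> + tensor_spinor K \<psi>"
  "tensor_spinor K (c *s \<phi>) = c *s tensor_spinor K \<phi>"
  "tensor_spinor K 0 = 0"
  by (simp_all add: tensor_spinor_def matrix_vector_right_distrib matrix_vector_scale vec.scale_right_distrib
      sum.distrib vec.scale_sum_right mult_ac)

lemma tensor_spinor_right_minus: "tensor_spinor K (- \<phi>) = - tensor_spinor K \<phi>"
  by (simp add: tensor_spinor_def matrix_vector_neg sum_negf vec.scale_minus_right)

lemma tensor_vec_add: "tensor_vec (K + L) v = tensor_vec K v + tensor_vec L v"
  and tensor_vec_scale: "tensor_vec (c *s K) v = c *s tensor_vec K v"
  and tensor_vec_zero: "tensor_vec 0 v = 0"
  by (simp_all add: tensor_vec_def vec_eq_iff sum.distrib sum_distrib_left algebra_simps)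

lemma tensor_vec_right:
  "tensor_vec K (v + w) = tensor_vec K v + tensor_vec K w" "tensor_vec K (c *s v) = c *s tensor_vec K v"
  by (simp_all add: tensor_vec_def vec_eq_iff sum.distrib sum_distrib_left algebra_simps)

lemma tensor_vec_wedge: "tensor_vec (wedge a b) v = cdot b v *s a - cdot a v *s b"
  by (simp add: tensor_vec_def wedge_def cdot_def vec_eq_iff left_diff_distrib right_diff_distrib sum_subtractf
      sum_distrib_left sum_distrib_right mult_ac)

lemma skew_wedge: "skew (wedge a b)"
  by (simp add: skew_def wedge_def)

lemma tensor_row_nth: "cdot (tensor_row K i) v = tensor_vec K v $ i"
  by (simp add: tensor_row_def tensor_vec_def cdot_def)

lemma vec_expand: "v = (\<Sum>i\<in>UNIV. v $ i *s axis i 1)" for v :: cvec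
  by (simp add: vec_eq_iff axis_def if_distrib[of "\<lambda>x. _ * x"] cong: if_cong)

lemma tensor_spinor_wedge: "tensor_spinor (wedge a b) \<phi> = a \<odot> b \<odot> \<phi> - b \<odot> a \<odot> \<phi>"
proof -
  have "tensor_row (wedge a b) i = a $ i *s b - b $ i *s a" for i
    by (simp add: tensor_row_def wedge_def vec_eq_iff algebra_simps)
  hence "tensor_spinor (wedge a b) \<phi>
      = (\<Sum>i\<in>UNIV. a $ i *s axis i 1 \<odot> (b \<odot> \<phi>)) - (\<Sum>i\<in>UNIV. b $ i *s axis i 1 \<odot> (a \<odot> \<phi>))"
    by (simp add: tensor_spinor_act skew_wedge act_simps sum_subtractf)
  also have "\<dots> = a \<odot> b \<odot> \<phi> - b \<odot> a \<odot> \<phi>"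
    unfolding act_left(3)[symmetric] act_sum_left[symmetric] vec_expand[symmetric] ..
  finally show ?thesis .
qed

lemma cdot_tensor_vec:
  assumes "skew K"
  shows "cdot (tensor_vec K v) w = - cdot v (tensor_vec K w)"
proof -
  have "cdot (tensor_vec K v) w = (\<Sum>i\<in>UNIV. \<Sum>j\<in>UNIV. K $ (i, j) * v $ j * w $ i)"
    by (simp add: cdot_def tensor_vec_def sum_distrib_right)
  also have "\<dots> = (\<Sum>j\<in>UNIV. \<Sum>i\<in>UNIV. - (v $ j * (K $ (j, i) * w $ i)))"
    by (subst sum.swap, intro sum.cong refl, subst skew_iff[OF assms]) simp
  also have "\<dots> = - cdot v (tensor_vec K w)"
    by (simp add: cdot_def tensor_vec_def sum_distrib_left sum_negf)
  finally show ?thesis .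
qed

text \<open>
  Bivectors generate infinitesimal rotations: the commutator with a vector is again a vector. One
  factor 2 comes from the Clifford relation, the other from summing over both orders of a pair.
\<close>
lemma act_tensor_spinor:
  assumes "skew K"
  shows "v \<odot> tensor_spinor K \<phi> = tensor_spinor K (v \<odot> \<phi>) - 4 *s (tensor_vec K v \<odot> \<phi>)"
proof -
  let ?e = "\<lambda>i. axis i 1 :: cvec" and ?k = "tensor_row K"
  have "v \<odot> ?e i \<odot> ?k i \<odot> \<phi> = (2 * v $ i) *s (?k i \<odot> \<phi>) - (2 * tensor_vec K v $ i) *s (?e i \<odot> \<phi>)
      + ?e i \<odot> ?k i \<odot> v \<odot> \<phi>" for i
    by (simp add: act_swap[of v "?e i"] act_swap[of v "?k i"] act_simps cdot_axis
        cdot_commute[of v "?k i"] tensor_row_nth)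
  hence "v \<odot> tensor_spinor K \<phi> = 2 *s ((\<Sum>i\<in>UNIV. v $ i *s ?k i) \<odot> \<phi>)
      - 2 *s ((\<Sum>i\<in>UNIV. tensor_vec K v $ i *s ?e i) \<odot> \<phi>) + tensor_spinor K (v \<odot> \<phi>)"
    by (simp add: tensor_spinor_act[OF assms] act_sum_right act_sum_left act_left sum.distrib
        sum_subtractf vec.scale_sum_right)
  also have "(\<Sum>i\<in>UNIV. v $ i *s ?k i) = - tensor_vec K v"
  proof -
    have "v $ i * K $ (i, j) = - (K $ (j, i) * v $ i)" for i j
      by (subst skew_iff[OF assms]) simp
    thus ?thesis by (simp add: vec_eq_iff tensor_row_def tensor_vec_def sum_negf)
  qed
  also have "(\<Sum>i\<in>UNIV. tensor_vec K v $ i *s ?e i) = tensor_vec K v"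
    by (rule vec_expand[symmetric])
  finally show ?thesis by (simp add: act_simps vec_eq_iff)
qed

lemma bform_tensor_spinor:
  assumes "skew K"
  shows "bform (tensor_spinor K \<phi>) \<psi> = - bform \<phi> (tensor_spinor K \<psi>)"
proof -
  have "tensor_row K i \<odot> axis i 1 \<odot> \<psi> = - (axis i 1 \<odot> tensor_row K i \<odot> \<psi>)" for i
    by (subst act_swap) (simp add: cdot_axis tensor_row_def skew_diag[OF assms])
  thus ?thesis
    by (simp add: tensor_spinor_act[OF assms] bform_sum_left bform_sum_right bform_act[symmetric] bform_simps sum_negf)
qed

section \<open>Products of gamma matrices in a pure spinor\<close>

text \<open>
  A function of lists that changes sign when two neighbours are exchanged also changes sign
  under an arbitrary transposition, a product of an odd number of exchanges of neighbours.
\<close>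
lemma swap_permute_list:
  assumes swap: "\<And>us i j vs. length us + length vs + 2 = n \<Longrightarrow>
      F (us @ i # j # vs) = - (F (us @ j # i # vs) :: 'b :: comm_ring_1)"
    and "a < b" "b < n" "length ys = n"
  shows "F (permute_list (Transposition.transpose a b) ys) = - F ys"
  using assms(2-4)
proof (induction "b - a" arbitrary: a b ys rule: less_induct)
  case less
  show ?case
  proof (cases "b = Suc a")
    case True
    let ?us = "take a ys" and ?vs = "drop (Suc (Suc a)) ys"
    have ys: "ys = ?us @ ys ! a # ys ! Suc a # ?vs"
      using less.prems True by (simp add: Cons_nth_drop_Suc)
    have "permute_list (Transposition.transpose a b) ys = ?us @ ys ! Suc a # ys ! a # ?vs"
    proof (rule nth_equalityI)
      show "length (permute_list (Transposition.transpose a b) ys) = length (?us @ ys ! Suc a # ys ! a # ?vs)"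
        using less.prems True by simp
      fix k assume "k < length (permute_list (Transposition.transpose a b) ys)"
      thus "permute_list (Transposition.transpose a b) ys ! k = (?us @ ys ! Suc a # ys ! a # ?vs) ! k"
        using less.prems True Suc_diff_Suc[of 1 k] Suc_diff_Suc[of 0 k]
        by (auto simp: permute_list_def nth_append nth_Cons' Transposition.transpose_def numeral_2_eq_2)
    qed
    also have "F \<dots> = - F (?us @ ys ! a # ys ! Suc a # ?vs)"
      using less.prems True by (intro swap) simp
    finally show ?thesis using ys by simp
  next
    case False
    define c where "c = b - 1"
    have c: "a < c" "c < b" "b = Suc c" using False less.prems by (auto simp: c_def)
    let ?t = "Transposition.transpose c b" and ?s = "Transposition.transpose a c"
    have perm: "Transposition.transpose x y permutes {..<n}" if "x < n" "y < n" for x y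
      using that by (intro permutes_swap_id) auto
    have "Transposition.transpose a b = ?t \<circ> ?s \<circ> ?t"
      using c by (auto simp: fun_eq_iff Transposition.transpose_def)
    hence "permute_list (Transposition.transpose a b) ys = permute_list ?t (permute_list ?s (permute_list ?t ys))"
      using less.prems c by (simp add: permute_list_compose perm)
    also have "F \<dots> = - F (permute_list ?s (permute_list ?t ys))"
      using less.prems c by (intro less.hyps) auto
    also have "F (permute_list ?s (permute_list ?t ys)) = - F (permute_list ?t ys)"
      using less.prems c by (intro less.hyps) auto
    also have "F (permute_list ?t ys) = - F ys"
      using less.prems c by (intro less.hyps) auto
    finally show ?thesis by simp
  qed
qed


lemma permute_list_sign:
  assumes swap: "\<And>us i j vs. length us + length vs + 2 = n \<Longrightarrow>
      F (us @ i # j # vs) = - (F (us @ j # i # vs) :: 'b :: comm_ring_1)"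
    and p: "p permutes {..<n}" and xs: "length xs = n"
  shows "F (permute_list p xs) = of_int (sign p) * F xs"
proof (rule permutes_rev_induct[OF _ p])
  fix a b q
  assume q: "q permutes {..<n}" and ab: "a \<in> {..<n}" "b \<in> {..<n}" "a \<noteq> b"
    and IH: "F (permute_list q xs) = of_int (sign q) * F xs"
  have t: "Transposition.transpose a b permutes {..<n}"
    using ab by (intro permutes_swap_id)
  have "F (permute_list (q \<circ> Transposition.transpose a b) xs)
      = F (permute_list (Transposition.transpose a b) (permute_list q xs))"
    using t xs by (simp add: permute_list_compose)
  also have "\<dots> = - F (permute_list q xs)"
  proof (cases "a < b")
    case True
    thus ?thesis using ab xs by (intro swap_permute_list[where F = F and n = n, OF swap]) auto
  next
    case False
    thus ?thesis using ab xs
      by (subst transpose_commute, intro swap_permute_list[where F = F and n = n, OF swap]) auto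
  qed
  also have "\<dots> = of_int (sign (q \<circ> Transposition.transpose a b)) * F xs"
  proof -
    have "sign (q \<circ> Transposition.transpose a b) = sign q * sign (Transposition.transpose a b)"
      using q t by (intro sign_compose) (auto intro: permutation_permutes[THEN iffD2])
    thus ?thesis using ab IH by (simp add: sign_swap_id)
  qed
  finally show "F (permute_list (q \<circ> Transposition.transpose a b) xs)
      = of_int (sign (q \<circ> Transposition.transpose a b)) * F xs" .
qed (simp_all add: sign_id)

definition gamma_form :: "spinor \<Rightarrow> 10 list \<Rightarrow> complex" where
  "gamma_form \<psi> is = bform \<psi> (gamma_prod is *v \<psi>)"

lemma gamma_prod_append: "gamma_prod (us @ vs) *v \<phi> = gamma_prod us *v (gamma_prod vs *v \<phi>)"
  by (induction us) (simp_all add: gamma_prod_vec)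

text \<open>
  Exchanging two neighbouring gamma matrices costs a sign and a product with these two
  removed. Where that shorter product has no expectation, products are already antisymmetric.
\<close>
lemma gamma_form_swap:
  assumes "gamma_form \<psi> (us @ vs) = 0"
  shows "gamma_form \<psi> (us @ i # j # vs) = - gamma_form \<psi> (us @ j # i # vs)"
proof -
  have "gamma i *v (gamma j *v \<phi>) = (if i = j then 2 else 0) *s \<phi> - gamma j *v (gamma i *v \<phi>)" for \<phi>
    using gamma_anticommute[of i j \<phi>] by (simp add: algebra_simps)
  hence "gamma_form \<psi> (us @ i # j # vs) = (if i = j then 2 else 0) * gamma_form \<psi> (us @ vs) - gamma_form \<psi> (us @ j # i # vs)"
    by (simp add: gamma_form_def gamma_prod_append gamma_prod_vec matrix_vector_mult_diff_distrib
        matrix_vector_scale bform_simps)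
  thus ?thesis using assms by simp
qed

lemma bform_gamma: "bform \<phi> (gamma i *v \<psi>) = bform (gamma i *v \<phi>) \<psi>"
  by (simp add: act_axis[symmetric] bform_act)

lemma bform_gamma_prod: "bform \<phi> (gamma_prod is *v \<psi>) = bform (gamma_prod (rev is) *v \<phi>) \<psi>"
  by (induction "is" arbitrary: \<phi>) (simp_all add: gamma_prod_vec gamma_prod_append bform_gamma)

lemma gamma_form_rev: "gamma_form \<psi> (rev is) = gamma_form \<psi> is"
  by (simp add: gamma_form_def bform_gamma_prod[of _ "is"] bform_commute)

text \<open>
  Purity makes the three-index form antisymmetric in its indices, hence odd under reversal. The
  symmetry of the bilinear form makes it even.
\<close>
lemma gamma_form_3:
  assumes "pure_spinor \<psi>" "length is = 3"
  shows "gamma_form \<psi> is = 0"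
proof -
  have 1: "gamma_form \<psi> [k] = 0" for k
    using assms(1) by (simp add: pure_spinor_def gamma_form_def gamma_prod_vec bil_eq_bform)
  obtain i j k where ijk: "is = [i, j, k]"
    using assms(2) by (auto simp: numeral_3_eq_3 length_Suc_conv)
  have "gamma_form \<psi> [i, j, k] = - gamma_form \<psi> [j, i, k]"
    using gamma_form_swap[of \<psi> "[]" "[k]" i j] 1 by simp
  also have "gamma_form \<psi> [j, i, k] = - gamma_form \<psi> [j, k, i]"
    using gamma_form_swap[of \<psi> "[j]" "[]" i k] 1 by simp
  also have "gamma_form \<psi> [j, k, i] = - gamma_form \<psi> [k, j, i]"
    using gamma_form_swap[of \<psi> "[]" "[i]" j k] 1 by simp
  also have "gamma_form \<psi> [k, j, i] = gamma_form \<psi> [i, j, k]"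
    using gamma_form_rev[of \<psi> "[i, j, k]"] by simp
  finally show ?thesis unfolding ijk by simp
qed

text \<open>
  As the three-index forms vanish, the form with five gamma matrices is already antisymmetric in
  its indices, also where indices repeat, so that antisymmetrisation does not change it.
\<close>
lemma gamma_form_asym_5:
  assumes "pure_spinor \<psi>" "length is = 5"
  shows "bil \<psi> (gamma_asym is) \<psi> = gamma_form \<psi> is"
proof -
  let ?P = "{p. p permutes {..<length is}}"
  have swap: "gamma_form \<psi> (us @ i # j # vs) = - gamma_form \<psi> (us @ j # i # vs)"
    if "length us + length vs + 2 = length is" for us i j vs
    using that assms(2) by (intro gamma_form_swap gamma_form_3[OF assms(1)]) simp
  have "bform \<psi> (gamma_prod (map (\<lambda>j. is ! p j) [0..<length is]) *v \<psi>) = of_int (sign p) * gamma_form \<psi> is"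
    if "p \<in> ?P" for p
    using permute_list_sign[where F = "gamma_form \<psi>", OF swap] that
    by (simp add: gamma_form_def permute_list_def)
  hence "bil \<psi> (gamma_asym is) \<psi>
      = 1 / fact (length is) * (\<Sum>p\<in>?P. of_int (sign p) * (of_int (sign p) * gamma_form \<psi> is))"
    by (simp add: bil_eq_bform gamma_asym_def matrix_vector_scaleR matrix_vector_sum_left bform_simps bform_sum_right)
  also have "\<dots> = 1 / fact (length is) * (\<Sum>p\<in>?P. gamma_form \<psi> is)"
  proof -
    have "of_int (sign p) * of_int (sign p) = (1 :: complex)" for p :: "nat \<Rightarrow> nat"
      by (simp only: of_int_mult[symmetric] sign_idempotent of_int_1)
    thus ?thesis by (simp only: mult.assoc[symmetric] mult_1_left)
  qed
  also have "\<dots> = gamma_form \<psi> is"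
    by (simp add: card_permutations)
  finally show ?thesis .
qed

text \<open>
  Removing the antisymmetrisation from \<open>\<Omega>bar\<close> lets the contraction with \<open>K\<close> twice factor through the
  action of \<open>K\<close> on spinors.
\<close>
lemma cdot_Omega_KK:
  assumes "pure_spinor \<psi>0" "skew K"
  shows "cdot y (Omega_KK \<psi>0 K)
    = 1 / (4 * complex_of_real (sqrt 2)) * bform \<psi>0 (y \<odot> tensor_spinor K (tensor_spinor K \<psi>0))"
proof -
  let ?c = "1 / (4 * complex_of_real (sqrt 2))"
  have asym: "bil \<psi>0 (gamma_asym [i, p, q, r, s]) \<psi>0 = gamma_form \<psi>0 [i, p, q, r, s]" for i p q r s
    by (rule gamma_form_asym_5[OF assms(1)]) simp
  have "Omega_KK \<psi>0 K $ i = ?c * (\<Sum>p\<in>UNIV. \<Sum>q\<in>UNIV. \<Sum>r\<in>UNIV. \<Sum>s\<in>UNIV.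
      K $ (p, q) * K $ (r, s) * gamma_form \<psi>0 [i, p, q, r, s])" for i
    unfolding Omega_KK_def Omega_bar_def vec_lambda_beta sum_distrib_left asym
    by (simp only: mult.assoc mult.commute mult.left_commute)
  moreover have "bform \<psi>0 (gamma i *v tensor_spinor K (tensor_spinor K \<psi>0))
      = (\<Sum>p\<in>UNIV. \<Sum>q\<in>UNIV. \<Sum>r\<in>UNIV. \<Sum>s\<in>UNIV.
      K $ (p, q) * K $ (r, s) * gamma_form \<psi>0 [i, p, q, r, s])" for i
    unfolding tensor_spinor_gamma[OF assms(2)] matrix_vector_sum_right matrix_vector_scale bform_sum_right
        bform_simps gamma_form_def gamma_prod_vec vec.scale_sum_right sum_distrib_left 
    by (simp only: mult.assoc)
  ultimately have O: "Omega_KK \<psi>0 K $ i = ?c * bform \<psi>0 (gamma i *v tensor_spinor K (tensor_spinor K \<psi>0))" for i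
    by (simp only:)
  show ?thesis
    unfolding cdot_def act_expand bform_sum_right bform_simps sum_distrib_left O
    by (simp only: mult.left_commute)
qed

section \<open>Linear algebra and the square root of 2\<close>

lemma dim_vcnj_le: "vec.dim (vcnj ` S) \<le> vec.dim S"
proof -
  obtain B where B: "B \<subseteq> S" "vec.independent B" "S \<subseteq> vec.span B" "card B = vec.dim S"
    by (rule vec.basis_exists)
  have fin: "finite B" using B(2) by (rule vec.finiteI_independent)
  have "vcnj v \<in> vec.span (vcnj ` B)" if "v \<in> vec.span B" for v
    using that
  proof (induction rule: vec.span_induct_alt)
    case base
    show ?case by (simp add: vec.span_zero)
  next
    case (step c x y)
    hence "vcnj x \<in> vec.span (vcnj ` B)" by (intro vec.span_base imageI)
    thus ?case using step by (simp add: vec.span_add vec.span_scale)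
  qed
  hence "vcnj ` S \<subseteq> vec.span (vcnj ` B)" using B(3) by blast
  hence "vec.dim (vcnj ` S) \<le> card (vcnj ` B)"
    using fin by (intro vec.dim_le_card) auto
  also have "\<dots> \<le> card B" using fin by (rule card_image_le)
  finally show ?thesis using B(4) by simp
qed

lemma vec_linearI:
  fixes f :: "'a :: field ^ 'm \<Rightarrow> 'a ^ 'n"
  assumes "\<And>x y. f (x + y) = f x + f y" "\<And>c x. f (c *s x) = c *s f x"
  shows "Vector_Spaces.linear (*s) (*s) f"
  using assms by (simp add: Vector_Spaces.linear_iff vec.vector_space_axioms)

lemma dim_image_subspace:
  fixes f :: "'a :: field ^ 'm \<Rightarrow> 'a ^ 'n"
  assumes "Vector_Spaces.linear (*s) (*s) f" "vec.subspace S" "inj_on f S"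
  shows "vec.dim (f ` S) = vec.dim S"
proof -
  have "vec.span S = S" using assms(2) by (simp only: vec.span_eq_iff)
  hence "inj_on f (vec.span S)" using assms(3) by (simp only:)
  thus ?thesis by (rule vec.dim_image_eq[OF assms(1)])
qed

lemma card_less_pairs:
  "2 * card {p :: 'i \<times> 'i. fst p < snd p} + CARD('i) = CARD('i :: {finite, linorder}) * CARD('i)"
proof -
  let ?A = "{p :: 'i \<times> 'i. fst p < snd p}" and ?B = "{p :: 'i \<times> 'i. snd p < fst p}"
    and ?D = "{p :: 'i \<times> 'i. fst p = snd p}"
  have "card ?B = card ?A"
    by (rule bij_betw_same_card[of prod.swap]) (auto simp: bij_betw_def inj_on_def image_iff)
  moreover have "card ?D = CARD('i)"
    by (rule bij_betw_same_card[of fst]) (auto simp: bij_betw_def inj_on_def image_iff)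
  moreover have "card (?A \<union> ?B \<union> ?D) = card ?A + card ?B + card ?D"
    by (subst card_Un_disjoint, auto)+
  moreover have "?A \<union> ?B \<union> ?D = UNIV" by (auto simp: set_eq_iff)
  moreover have "CARD('i \<times> 'i) = CARD('i) * CARD('i)" by simp
  ultimately show ?thesis by (simp only:) 
qed

lemma independent_family:
  fixes b :: "'i :: finite \<Rightarrow> complex ^ 'n"
  assumes "vec.independent B" "bij_betw b UNIV B" "(\<Sum>i\<in>UNIV. c i *s b i) = 0"
  shows "c i = 0"
proof -
  have fin: "finite B" using assms(1) by (rule vec.finiteI_independent)
  let ?u = "\<lambda>v. c (the_inv_into UNIV b v)"
  have inj: "inj b" using assms(2) by (rule bij_betw_imp_inj_on)
  have "(\<Sum>v\<in>B. ?u v *s v) = (\<Sum>i\<in>UNIV. ?u (b i) *s b i)"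
    using sum.reindex_bij_betw[OF assms(2), of "\<lambda>v. ?u v *s v"] by simp
  also have "\<dots> = 0" using assms(3) by (simp add: the_inv_f_f[OF inj])
  finally have "\<forall>v\<in>B. ?u v = 0"
    using assms(1) fin by (auto simp: vec.dependent_finite)
  moreover have "b i \<in> B" using assms(2) by (auto simp: bij_betw_def)
  ultimately have "?u (b i) = 0" by blast
  thus ?thesis by (simp add: the_inv_f_f[OF inj])
qed

abbreviation (input) root2 :: complex where "root2 \<equiv> complex_of_real (sqrt 2)"

lemma root2_square: "root2 * root2 = 2" "root2 * (root2 * x) = 2 * x"
proof -
  show 1: "root2 * root2 = 2" by (simp flip: of_real_mult)
  show "root2 * (root2 * x) = 2 * x" by (simp only: mult.assoc[symmetric] 1)
qed

lemma inverse_root2: "1 / root2 = root2 / 2"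
  by (simp add: field_simps root2_square)

section \<open>The two isotropic spaces of a pure spinor\<close>

locale pure_vacuum =
  fixes \<psi>0 :: spinor
  assumes chiral: "\<psi>0 \<in> Delta_plus" and pure: "pure_spinor \<psi>0" and normalised: "normalised \<psi>0"
begin

definition N :: "cvec set" where "N = {w. w \<odot> \<psi>0 = 0}"

definition Nbar :: "cvec set" where "Nbar = {w. vcnj w \<in> N}"

definition \<psi>bar :: spinor where "\<psi>bar = majorana \<psi>0"

lemma hform_vacuum: "hform \<psi>0 \<psi>0 = 1"
  using normalised by (simp add: normalised_def herm_eq_hform)

lemma hform_psibar: "hform \<psi>bar \<psi>bar = 1"
  by (simp add: \<psi>bar_def hform_majorana_majorana hform_vacuum)

lemma bform_vacuum_psibar: "bform \<psi>0 \<psi>bar = 1" "bform \<psi>bar \<psi>0 = 1"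
  by (simp_all add: bform_commute[of \<psi>bar] bform_eq_hform \<psi>bar_def hform_majorana_majorana hform_vacuum)

lemma vacuum_nonzero: "\<psi>0 \<noteq> 0"
  using hform_vacuum by (auto simp: hform_simps)

lemma bform_vacuum_act: "bform \<psi>0 (v \<odot> \<psi>0) = 0"
  using pure by (simp add: act_expand bform_sum_right bform_simps pure_spinor_def bil_eq_bform)

lemma hform_vacuum_act_psibar: "hform \<psi>0 (v \<odot> \<psi>bar) = 0"
proof -
  have "hform \<psi>0 (v \<odot> \<psi>bar) = cnj (bform \<psi>0 (vcnj v \<odot> \<psi>0))"
    by (simp add: hform_act bform_eq_hform hform_cnj \<psi>bar_def)
  thus ?thesis by (simp add: bform_vacuum_act)
qed

definition current :: "spinor \<Rightarrow> cvec" where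
  "current \<phi> = (\<chi> i. bform \<psi>0 (gamma i *v \<phi>))"

lemma cdot_current: "cdot v (current \<phi>) = bform \<psi>0 (v \<odot> \<phi>)"
  by (simp add: current_def cdot_def act_expand bform_sum_right bform_simps)

text \<open>
  Apply the nullity to \<open>\<psi>0 + \<phi>\<close>, \<open>\<psi>0 - \<phi>\<close> and \<open>\<phi>\<close>. As \<open>\<psi>0\<close> is pure, the sum of the first
  two is eight times the norm of the current plus twice the norm that vanishes by the third.
\<close>
lemma current_null:
  assumes "\<phi> \<in> Delta_plus"
  shows "cdot (current \<phi>) (current \<phi>) = 0"
proof -
  let ?\<beta> = "\<lambda>i. bform \<psi>0 (gamma i *v \<phi>)" and ?\<delta> = "\<lambda>i. bform \<phi> (gamma i *v \<phi>)"
  have mem: "\<psi>0 + \<phi> \<in> Delta_plus" "\<psi>0 + (- 1) *s \<phi> \<in> Delta_plus"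
    by (intro vec.subspace_add vec.subspace_scale Delta_plus_subspace chiral assms)+
  have 0: "bform \<psi>0 (gamma i *v \<psi>0) = 0" for i
    using pure by (simp add: pure_spinor_def bil_eq_bform)
  have sym: "bform \<phi> (gamma i *v \<psi>0) = ?\<beta> i" for i
    by (simp add: bform_gamma[of \<phi>] bform_commute)
  have p: "bform (\<psi>0 + \<phi>) (gamma i *v (\<psi>0 + \<phi>)) = 2 * ?\<beta> i + ?\<delta> i" for i
    by (simp add: matrix_vector_right_distrib bform_simps bform_simps_left 0 sym)
  have m: "bform (\<psi>0 + (- 1) *s \<phi>) (gamma i *v (\<psi>0 + (- 1) *s \<phi>)) = - 2 * ?\<beta> i + ?\<delta> i" for i
    by (simp only: matrix_vector_right_distrib matrix_vector_scale bform_simps bform_simps_left 0 sym)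
      (simp add: algebra_simps)
  have "(\<Sum>i\<in>UNIV. (2 * ?\<beta> i + ?\<delta> i)\<^sup>2) = 0"
    using chiral_vector_null[OF mem(1)] unfolding p .
  moreover have "(\<Sum>i\<in>UNIV. (- 2 * ?\<beta> i + ?\<delta> i)\<^sup>2) = 0"
    using chiral_vector_null[OF mem(2)] unfolding m .
  moreover have "(\<Sum>i\<in>UNIV. (?\<delta> i)\<^sup>2) = 0"
    by (rule chiral_vector_null[OF assms])
  moreover have "8 * (\<Sum>i\<in>UNIV. (?\<beta> i)\<^sup>2) = (\<Sum>i\<in>UNIV. (2 * ?\<beta> i + ?\<delta> i)\<^sup>2)
      + (\<Sum>i\<in>UNIV. (- 2 * ?\<beta> i + ?\<delta> i)\<^sup>2) - 2 * (\<Sum>i\<in>UNIV. (?\<delta> i)\<^sup>2)"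
    unfolding sum_distrib_left sum.distrib[symmetric] sum_subtractf[symmetric]
    by (intro sum.cong refl) (simp add: power2_eq_square algebra_simps)
  ultimately have "8 * (\<Sum>i\<in>UNIV. (?\<beta> i)\<^sup>2) = 0" by simp
  thus ?thesis by (simp add: cdot_def current_def power2_eq_square)
qed

lemma current_add: "current (\<phi> + \<psi>) = current \<phi> + current \<psi>"
  by (simp add: current_def vec_eq_iff matrix_vector_right_distrib bform_simps)

text \<open>
  By polarisation all currents are orthogonal to each other, so \<open>current \<phi> \<odot> \<psi>0\<close> pairs to zero with
  every chiral spinor, in particular with its own charge conjugate. That pairing is its norm.
\<close>
lemma current_in_N:
  assumes "\<phi> \<in> Delta_plus"
  shows "current \<phi> \<in> N"
proof -
  let ?X = "current \<phi> \<odot> \<psi>0"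
  have orth: "bform ?X \<phi>' = 0" if "\<phi>' \<in> Delta_plus" for \<phi>'
  proof -
    have "cdot (current (\<phi> + \<phi>')) (current (\<phi> + \<phi>')) = 0"
      by (intro current_null vec.subspace_add Delta_plus_subspace assms that)
    hence "cdot (current \<phi>) (current \<phi>') = 0"
      using current_null[OF assms] current_null[OF that]
      by (simp add: current_add cdot_simps cdot_commute[of "current \<phi>'" "current \<phi>"])
    thus ?thesis by (simp add: cdot_current bform_act)
  qed
  have "majorana ?X \<in> Delta_plus"
    by (intro majorana_Delta_minus act_Delta_plus chiral)
  from orth[OF this] have "hform ?X ?X = 0"
    by (simp add: bform_eq_hform hform_majorana_majorana)
  thus ?thesis by (simp add: N_def hform_self_eq_0)
qed

lemma psibar_chiral: "\<psi>bar \<in> Delta_minus"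
  unfolding \<psi>bar_def by (intro majorana_Delta_plus chiral)

text \<open>
  On \<open>N\<close> this is the identity, since moving \<open>v\<close> to the left produces twice its components; on
  \<open>Nbar\<close> it vanishes, because \<open>\<psi>bar\<close> is annihilated.
\<close>
definition projN :: "cvec \<Rightarrow> cvec" where
  "projN v = (1 / 2) *s current (v \<odot> \<psi>bar)"

lemma N_subspace: "vec.subspace N"
  by (auto simp: vec.subspace_def N_def act_simps)

lemma Nbar_subspace: "vec.subspace Nbar"
  using N_subspace by (auto simp: vec.subspace_def Nbar_def)

lemma projN_in_N: "projN v \<in> N"
  unfolding projN_def
  by (intro vec.subspace_scale N_subspace current_in_N act_Delta_minus psibar_chiral)

text \<open>
  The complementary projection is the complex conjugate of this one, and hence lands in \<open>Nbar\<close>.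
\<close>
lemma vcnj_projN: "vcnj (projN v) = vcnj v - projN (vcnj v)"
proof -
  have "cnj (bform \<psi>0 (gamma i *v (v \<odot> \<psi>bar))) = 2 * cnj (v $ i) - bform \<psi>0 (gamma i *v (vcnj v \<odot> \<psi>bar))" for i
  proof -
    have "cnj (bform \<psi>0 (gamma i *v (v \<odot> \<psi>bar))) = hform (axis i 1 \<odot> v \<odot> \<psi>bar) \<psi>bar"
      by (simp add: bform_eq_hform hform_cnj \<psi>bar_def act_axis)
    also have "\<dots> = hform \<psi>bar (vcnj v \<odot> axis i 1 \<odot> \<psi>bar)"
    proof -
      have "vcnj (axis i 1) = axis i 1" by (simp add: vcnj_def axis_def vec_eq_iff)
      thus ?thesis by (simp add: hform_act)
    qed
    also have "\<dots> = 2 * vcnj v $ i - hform \<psi>bar (axis i 1 \<odot> vcnj v \<odot> \<psi>bar)"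
      by (subst act_swap) (simp add: hform_simps hform_psibar cdot_axis)
    finally show ?thesis by (simp add: bform_eq_hform \<psi>bar_def act_axis vcnj_def)
  qed
  thus ?thesis by (simp add: projN_def current_def vec_eq_iff vcnj_def right_diff_distrib)
qed

lemma split_N_Nbar: obtains a b where "a \<in> N" "b \<in> Nbar" "v = a + b"
proof
  show "projN v \<in> N" by (rule projN_in_N)
  show "v - projN v \<in> Nbar" by (simp add: Nbar_def vcnj_projN projN_in_N)
qed simp

lemma N_isotropic:
  assumes "a \<in> N" "a' \<in> N"
  shows "cdot a a' = 0"
  using clifford_relation[of a a' \<psi>0] assms vacuum_nonzero by (simp add: N_def act_simps)

lemma cdot_vcnj: "cdot (vcnj v) (vcnj w) = cnj (cdot v w)"
  by (simp add: cdot_def vcnj_def)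

lemma Nbar_isotropic: "b \<in> Nbar \<Longrightarrow> b' \<in> Nbar \<Longrightarrow> cdot b b' = 0"
  using N_isotropic[of "vcnj b" "vcnj b'"] by (simp add: Nbar_def cdot_vcnj)

lemma N_Nbar_disjoint:
  assumes "v \<in> N" "v \<in> Nbar"
  shows "v = 0"
  using N_isotropic[of "vcnj v" v] assms cdot_vcnj_self[of v] by (simp add: Nbar_def)

lemma Nbar_eq_0:
  assumes "b \<in> Nbar" "\<And>a. a \<in> N \<Longrightarrow> cdot a b = 0"
  shows "b = 0"
  using assms(2)[of "vcnj b"] assms(1) cdot_vcnj_self[of b] by (simp add: Nbar_def)

lemma N_eq_0:
  assumes "a \<in> N" "\<And>b. b \<in> Nbar \<Longrightarrow> cdot a b = 0"
  shows "a = 0"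
  using assms(2)[of "vcnj a"] assms(1) cdot_vcnj_self[of a]
  by (simp add: Nbar_def cdot_commute)

lemma in_N_if_orthogonal:
  assumes "\<And>a. a \<in> N \<Longrightarrow> cdot a v = 0"
  shows "v \<in> N"
proof -
  obtain a b where ab: "a \<in> N" "b \<in> Nbar" "v = a + b" by (rule split_N_Nbar)
  have "b = 0"
  proof (rule Nbar_eq_0[OF ab(2)])
    fix c assume "c \<in> N"
    thus "cdot c b = 0" using assms[of c] ab N_isotropic[of c a] by (simp add: cdot_simps)
  qed
  thus ?thesis using ab by simp
qed

lemma N_vacuum: "a \<in> N \<Longrightarrow> a \<odot> \<psi>0 = 0"
  by (simp add: N_def)

lemma bform_vacuum_N: "a \<in> N \<Longrightarrow> bform \<psi>0 (a \<odot> \<phi>) = 0"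
  by (simp add: bform_act N_vacuum bform_simps_left)

lemma Nbar_psibar: "b \<in> Nbar \<Longrightarrow> b \<odot> \<psi>bar = 0"
  using majorana_act[of "vcnj b" \<psi>0] by (simp add: Nbar_def N_def \<psi>bar_def majorana_simps)

lemma hform_vacuum_Nbar: "b \<in> Nbar \<Longrightarrow> hform \<psi>0 (b \<odot> \<phi>) = 0"
  by (simp add: hform_act Nbar_def N_def hform_simps)

text \<open>
  A vector in \<open>N\<close> annihilates \<open>\<psi>0\<close>, so for it only the second term of the commutator is nonzero;
  the adjoint of a vector in \<open>Nbar\<close> annihilates \<open>\<psi>0\<close>, which leaves the first. The opposite signs
  of the two terms become the opposite eigenvalues of \<open>J\<close>.
\<close>
lemma J_expand: "J \<psi>0 v $ i = \<i> / 2 * (hform \<psi>0 (axis i 1 \<odot> v \<odot> \<psi>0) - hform \<psi>0 (v \<odot> axis i 1 \<odot> \<psi>0))"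
  by (simp add: J_def herm_eq_hform matrix_vector_mult_diff_rdistrib matrix_vector_mul_assoc[symmetric]
      act_axis hform_simps) (simp add: act_def)

lemma J_add: "J \<psi>0 (v + w) = J \<psi>0 v + J \<psi>0 w"
  by (simp add: vec_eq_iff J_expand act_simps hform_simps algebra_simps add_divide_distrib)

lemma J_N:
  assumes "a \<in> N"
  shows "J \<psi>0 a = - \<i> *s a"
proof -
  have "hform \<psi>0 (a \<odot> axis i 1 \<odot> \<psi>0) = 2 * a $ i" for i
    by (subst act_swap) (simp add: N_vacuum[OF assms] act_simps hform_simps hform_vacuum cdot_axis)
  thus ?thesis
    by (simp add: vec_eq_iff J_expand N_vacuum[OF assms] act_simps hform_simps)
qed

lemma J_Nbar:
  assumes "b \<in> Nbar"
  shows "J \<psi>0 b = \<i> *s b"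
proof -
  have "hform \<psi>0 (axis i 1 \<odot> b \<odot> \<psi>0) = 2 * b $ i" for i
    by (subst act_swap) (simp add: hform_vacuum_Nbar[OF assms] hform_simps hform_vacuum cdot_axis)
  thus ?thesis
    by (simp add: vec_eq_iff J_expand hform_vacuum_Nbar[OF assms])
qed

lemma type01_eq_N: "type01 \<psi>0 = N"
proof -
  have "v \<in> N" if "J \<psi>0 v = (- \<i>) *s v" for v
  proof -
    obtain a b where ab: "a \<in> N" "b \<in> Nbar" "v = a + b" by (rule split_N_Nbar)
    from that have "b = 0" by (simp add: ab(3) J_add J_N[OF ab(1)] J_Nbar[OF ab(2)] vec_eq_iff algebra_simps)
    thus ?thesis using ab by simp
  qed
  thus ?thesis using J_N by (auto simp: type01_def)
qed

lemma type10_eq_Nbar: "type10 \<psi>0 = Nbar"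
proof -
  have "v \<in> Nbar" if "J \<psi>0 v = \<i> *s v" for v
  proof -
    obtain a b where ab: "a \<in> N" "b \<in> Nbar" "v = a + b" by (rule split_N_Nbar)
    from that have "a = 0" by (simp add: ab(3) J_add J_N[OF ab(1)] J_Nbar[OF ab(2)] vec_eq_iff algebra_simps)
    thus ?thesis using ab by simp
  qed
  thus ?thesis using J_Nbar by (auto simp: type10_def)
qed

section \<open>Tensors of type (2,0)\<close>

lemma type20_induct [consumes 1, case_names zero add scale wedge]:
  assumes "K \<in> type20 \<psi>0" "P 0" "\<And>K L. P K \<Longrightarrow> P L \<Longrightarrow> P (K + L)" "\<And>c K. P K \<Longrightarrow> P (c *s K)"
    "\<And>v w. v \<in> Nbar \<Longrightarrow> w \<in> Nbar \<Longrightarrow> P (wedge v w)"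
  shows "P K"
  using assms(1) unfolding type20_def type10_eq_Nbar
proof (induction rule: vec.span_induct_alt)
  case base
  show ?case by (rule assms(2))
next
  case (step c L M)
  then obtain v w where vw: "v \<in> Nbar" "w \<in> Nbar" "L = wedge v w" by blast
  show ?case unfolding vw(3) by (intro assms(3,4,5) vw step)
qed

lemma type20_subspace: "vec.subspace (type20 \<psi>0)"
  by (simp add: type20_def vec.subspace_span)

lemma skew_type20: "K \<in> type20 \<psi>0 \<Longrightarrow> skew K"
  by (induction rule: type20_induct) (auto intro: skew_zero skew_add skew_scale skew_wedge)

lemma tensor_vec_Nbar: "K \<in> type20 \<psi>0 \<Longrightarrow> b \<in> Nbar \<Longrightarrow> tensor_vec K b = 0"
  by (induction rule: type20_induct)
    (auto simp: tensor_vec_zero tensor_vec_add tensor_vec_scale tensor_vec_wedge Nbar_isotropic)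

lemma tensor_vec_in_Nbar: "K \<in> type20 \<psi>0 \<Longrightarrow> tensor_vec K v \<in> Nbar"
  by (induction rule: type20_induct)
    (auto simp: tensor_vec_zero tensor_vec_add tensor_vec_scale tensor_vec_wedge
      intro: vec.subspace_0 vec.subspace_add vec.subspace_diff vec.subspace_scale Nbar_subspace)

lemma hform_vacuum_tensor: "K \<in> type20 \<psi>0 \<Longrightarrow> hform \<psi>0 (tensor_spinor K \<phi>) = 0"
  by (induction rule: type20_induct)
    (auto simp: tensor_spinor_zero tensor_spinor_add tensor_spinor_scale tensor_spinor_wedge hform_simps hform_vacuum_Nbar)

lemma tensor_psibar: "K \<in> type20 \<psi>0 \<Longrightarrow> tensor_spinor K \<psi>bar = 0"
  by (induction rule: type20_induct)
    (auto simp: tensor_spinor_zero tensor_spinor_add tensor_spinor_scale tensor_spinor_wedge Nbar_psibar act_simps)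

lemma tensor_Delta_plus: "K \<in> type20 \<psi>0 \<Longrightarrow> \<phi> \<in> Delta_plus \<Longrightarrow> tensor_spinor K \<phi> \<in> Delta_plus"
  by (induction rule: type20_induct)
    (auto simp: tensor_spinor_zero tensor_spinor_add tensor_spinor_scale tensor_spinor_wedge
      intro: vec.subspace_0 vec.subspace_add vec.subspace_diff vec.subspace_scale Delta_plus_subspace
        act_Delta_minus act_Delta_plus)

lemma Nbar_tensor: "K \<in> type20 \<psi>0 \<Longrightarrow> b \<in> Nbar \<Longrightarrow> b \<odot> tensor_spinor K \<phi> = tensor_spinor K (b \<odot> \<phi>)"
  by (simp add: act_tensor_spinor skew_type20 tensor_vec_Nbar act_simps)

lemma N_tensor_vacuum:
  "K \<in> type20 \<psi>0 \<Longrightarrow> a \<in> N \<Longrightarrow> a \<odot> tensor_spinor K \<psi>0 = - 4 *s (tensor_vec K a \<odot> \<psi>0)"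
  by (simp add: act_tensor_spinor skew_type20 N_vacuum tensor_spinor_right)

text \<open>
  The three factors from \<open>Nbar\<close> anticommute, so this is a three-index form and is odd under
  reversal.
\<close>
lemma bform_vacuum_Nbar_tensor:
  assumes K: "K \<in> type20 \<psi>0" and b: "b \<in> Nbar"
  shows "bform \<psi>0 (b \<odot> tensor_spinor K \<psi>0) = 0"
proof -
  have "bform \<psi>0 (b \<odot> tensor_spinor K \<psi>0) = bform \<psi>0 (tensor_spinor K (b \<odot> \<psi>0))"
    by (simp add: Nbar_tensor K b)
  also have "\<dots> = - bform (tensor_spinor K \<psi>0) (b \<odot> \<psi>0)"
    by (simp add: bform_tensor_spinor skew_type20 K)
  also have "bform (tensor_spinor K \<psi>0) (b \<odot> \<psi>0) = bform \<psi>0 (b \<odot> tensor_spinor K \<psi>0)"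
    using bform_act[of "tensor_spinor K \<psi>0" b \<psi>0] bform_commute by metis
  finally show ?thesis by simp
qed

text \<open>
  The spaces \<open>Nbar \<psi>0\<close> and \<open>N \<psi>bar\<close> are dual to each other under the bilinear form; this
  extracts the component \<open>w \<psi>bar\<close> of a spinor.
\<close>
lemma bform_vacuum_pair:
  assumes "b \<in> Nbar"
  shows "bform \<psi>0 (b \<odot> a \<odot> \<psi>bar) = 2 * cdot a b"
  by (subst act_swap) (simp add: assms Nbar_psibar act_simps bform_simps bform_vacuum_psibar cdot_commute)

lemma type20_eq_0:
  assumes K: "K \<in> type20 \<psi>0" and "\<And>a. a \<in> N \<Longrightarrow> tensor_vec K a = 0"
  shows "K = 0"
proof -
  have "tensor_vec K v = 0" for v
  proof -
    obtain a b where ab: "a \<in> N" "b \<in> Nbar" "v = a + b" by (rule split_N_Nbar)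
    thus ?thesis using assms by (simp add: tensor_vec_right tensor_vec_Nbar)
  qed
  hence "tensor_vec K (axis j 1) $ i = 0" for i j by simp
  moreover have "tensor_vec K (axis j 1) $ i = K $ (i, j)" for i j
    by (simp add: tensor_vec_def axis_def if_distrib[of "\<lambda>x. _ * x"] cong: if_cong)
  ultimately show "K = 0" by (simp add: vec_eq_iff)
qed

text \<open>
  The components are read off one after the other: \<open>f\<close> by the Hermitian pairing with \<open>\<psi>0\<close>, then
  \<open>w\<close> by the bilinear pairing with \<open>Nbar \<psi>0\<close>, then \<open>K\<close> by applying elements of \<open>N\<close>.
\<close>
lemma components_eq_0:
  assumes "f *s \<psi>0 + tensor_spinor K \<psi>0 + w \<odot> \<psi>bar = 0" and K: "K \<in> type20 \<psi>0" and w: "w \<in> N"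
  shows "f = 0" "K = 0" "w = 0"
proof -
  have "hform \<psi>0 (f *s \<psi>0 + tensor_spinor K \<psi>0 + w \<odot> \<psi>bar) = f"
    by (simp add: hform_simps hform_vacuum hform_vacuum_tensor K hform_vacuum_act_psibar)
  thus f: "f = 0" using assms(1) by (simp add: hform_simps)
  show w0: "w = 0"
  proof (rule N_eq_0[OF w])
    fix b assume b: "b \<in> Nbar"
    have "bform \<psi>0 (b \<odot> (f *s \<psi>0 + tensor_spinor K \<psi>0 + w \<odot> \<psi>bar)) = 2 * cdot w b"
      by (simp add: act_simps bform_simps f bform_vacuum_Nbar_tensor K b bform_vacuum_pair)
    thus "cdot w b = 0" using assms(1) by (simp add: act_simps bform_simps)
  qed
  have tK: "tensor_spinor K \<psi>0 = 0"
    using assms(1) f w0 by (simp add: act_simps)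
  show "K = 0"
  proof (rule type20_eq_0[OF K])
    fix a assume a: "a \<in> N"
    have "tensor_vec K a \<odot> \<psi>0 = 0"
      using N_tensor_vacuum[OF K a] tK by (simp add: act_simps)
    thus "tensor_vec K a = 0"
      by (intro N_Nbar_disjoint) (simp_all add: N_def tensor_vec_in_Nbar K)
  qed
qed

section \<open>Dimensions and the decomposition of chiral spinors\<close>

lemma vcnj_N: "vcnj ` N = Nbar" "vcnj ` Nbar = N"
proof -
  have "v \<in> vcnj ` N" if "v \<in> Nbar" for v
    using that by (intro image_eqI[of _ _ "vcnj v"]) (auto simp: Nbar_def)
  thus "vcnj ` N = Nbar" by (auto simp: Nbar_def)
  have "v \<in> vcnj ` Nbar" if "v \<in> N" for v
    using that by (intro image_eqI[of _ _ "vcnj v"]) (auto simp: Nbar_def)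
  thus "vcnj ` Nbar = N" by (auto simp: Nbar_def)
qed

lemma dim_N: "vec.dim N = 5" and dim_Nbar: "vec.dim Nbar = 5"
proof -
  have "{x + y | x y. x \<in> N \<and> y \<in> Nbar} = UNIV"
    using split_N_Nbar by (auto simp: set_eq_iff) metis
  moreover have "N \<inter> Nbar = {0}"
    using N_Nbar_disjoint by (auto simp: vec.subspace_0 N_subspace Nbar_subspace)
  ultimately have "vec.dim N + vec.dim Nbar = 10"
    using vec.dim_sums_Int[OF N_subspace Nbar_subspace] by (simp add: card_cart_basis)
  moreover have "vec.dim N = vec.dim Nbar"
    using dim_vcnj_le[of N] dim_vcnj_le[of Nbar] by (simp add: vcnj_N)
  ultimately show "vec.dim N = 5" "vec.dim Nbar = 5" by simp_all
qed

text \<open>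
  The wedges \<open>b i \<and> b j\<close>, \<open>i < j\<close>, of a basis of \<open>Nbar\<close> are independent. That the
  dimension is not larger follows below from the injection \<open>K \<mapsto> K \<psi>0\<close> into \<open>\<Delta>\<^sup>+\<close>.
\<close>
lemma dim_type20_ge: "10 \<le> vec.dim (type20 \<psi>0)"
proof -
  obtain B where B: "B \<subseteq> Nbar" "vec.independent B" "Nbar \<subseteq> vec.span B" "card B = vec.dim Nbar"
    by (rule vec.basis_exists)
  have fin: "finite B" using B(2) by (rule vec.finiteI_independent)
  obtain b :: "5 \<Rightarrow> cvec" where b: "bij_betw b UNIV B"
    using finite_same_card_bij[of "UNIV :: 5 set" B] fin B(4) dim_Nbar by auto
  have bN: "b i \<in> Nbar" for i using b B(1) by (auto simp: bij_betw_def)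
  let ?P = "{p :: 5 \<times> 5. fst p < snd p}"
  let ?T = "{c :: complex ^ (5 \<times> 5). \<forall>p. p \<notin> ?P \<longrightarrow> c $ p = 0}"
  define L :: "complex ^ (5 \<times> 5) \<Rightarrow> tensor2" where
    "L = (\<lambda>c. \<Sum>i\<in>UNIV. \<Sum>j\<in>UNIV. c $ (i, j) *s wedge (b i) (b j))"
  have sub: "vec.subspace ?T"
    by (auto simp: vec.subspace_def)
  have lin: "Vector_Spaces.linear (*s) (*s) L"
    by (rule vec_linearI)
      (simp_all add: L_def vec.scale_left_distrib sum.distrib vec.scale_sum_right)
  have "inj_on L ?T"
  proof (rule inj_onI)
    fix c d assume c: "c \<in> ?T" and d: "d \<in> ?T" and eq: "L c = L d"
    define e where "e = c - d"
    have e: "e $ (i, j) = 0" if "\<not> i < j" for i j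
      using c d that by (simp add: e_def)
    have "L (e + d) = L e + L d"
      using lin unfolding Vector_Spaces.linear_iff by blast
    hence Le: "L e = 0" using eq by (simp add: e_def)
    have "(\<Sum>j\<in>UNIV. (e $ (i, j) - e $ (j, i)) * b j $ k) = 0" for i k
    proof (rule independent_family[OF B(2) b])
      show "(\<Sum>i\<in>UNIV. (\<Sum>j\<in>UNIV. (e $ (i, j) - e $ (j, i)) * b j $ k) *s b i) = 0"
      proof (rule vec_eq_iff[THEN iffD2], rule allI)
        fix l
        have "0 = L e $ (l, k)" by (simp add: Le)
        also have "\<dots> = (\<Sum>i\<in>UNIV. \<Sum>j\<in>UNIV. e $ (i, j) * (b i $ l * b j $ k))
            - (\<Sum>j\<in>UNIV. \<Sum>i\<in>UNIV. e $ (j, i) * (b j $ k * b i $ l))"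
          by (simp add: L_def wedge_def right_diff_distrib sum_subtractf)
        also have "(\<Sum>j\<in>UNIV. \<Sum>i\<in>UNIV. e $ (j, i) * (b j $ k * b i $ l))
            = (\<Sum>i\<in>UNIV. \<Sum>j\<in>UNIV. e $ (j, i) * (b j $ k * b i $ l))"
          by (rule sum.swap)
        finally show "(\<Sum>i\<in>UNIV. (\<Sum>j\<in>UNIV. (e $ (i, j) - e $ (j, i)) * b j $ k) *s b i) $ l = 0 $ l"
          by (simp add: sum_distrib_left sum_distrib_right left_diff_distrib right_diff_distrib
                sum_subtractf mult_ac)
      qed
    qed
    hence "(\<Sum>j\<in>UNIV. (e $ (i, j) - e $ (j, i)) *s b j) = 0" for i
      by (simp only: vec_eq_iff sum_component vector_smult_component zero_index simp_thms)
    from independent_family[OF B(2) b this] have sym: "e $ (i, j) = e $ (j, i)" for i j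
      by simp
    have "e $ (i, j) = 0" for i j
    proof (cases "i < j")
      case True
      hence "e $ (j, i) = 0" by (intro e) auto
      thus ?thesis by (simp only: sym[of i j])
    qed (simp add: e)
    hence "e = 0" by (simp add: vec_eq_iff)
    thus "c = d" by (simp add: e_def)
  qed
  hence "vec.dim (L ` ?T) = vec.dim ?T"
    by (intro dim_image_subspace lin sub)
  also have "\<dots> = card ?P" by (rule dim_substandard_cart)
  also have "\<dots> = 10" using card_less_pairs[where 'i = 5] by simp
  finally have dim: "vec.dim (L ` ?T) = 10" .
  have "L ` ?T \<subseteq> type20 \<psi>0"
    unfolding L_def
    by (auto intro!: vec.subspace_sum[OF type20_subspace] vec.subspace_scale[OF type20_subspace])
       (auto simp: type20_def type10_eq_Nbar intro!: vec.span_base bN)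
  from vec.dim_subset[OF this] show ?thesis unfolding dim .
qed

text \<open>
  The three families of spinors have dimensions 1, at least 10, and 5, and meet only in 0. There
  is exactly enough room for them in the 16 dimensions of \<open>\<Delta>\<^sup>+\<close>.
\<close>
lemma dim_type20: "vec.dim (type20 \<psi>0) = 10"
  and spinor_decomposition:
    "\<phi> \<in> Delta_plus \<Longrightarrow> \<exists>f. \<exists>K\<in>type20 \<psi>0. \<exists>w\<in>N. \<phi> = f *s \<psi>0 + tensor_spinor K \<psi>0 + w \<odot> \<psi>bar"
proof -
  let ?S1 = "vec.span {\<psi>0}" and ?S2 = "(\<lambda>K. tensor_spinor K \<psi>0) ` type20 \<psi>0"
    and ?S3 = "(\<lambda>w. w \<odot> \<psi>bar) ` N"
  have lin2: "Vector_Spaces.linear (*s) (*s) (\<lambda>K. tensor_spinor K \<psi>0)"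
    by (intro vec_linearI tensor_spinor_add tensor_spinor_scale)
  have lin3: "Vector_Spaces.linear (*s) (*s) (\<lambda>w. w \<odot> \<psi>bar)"
    by (intro vec_linearI act_left)
  have sub: "vec.subspace ?S1" "vec.subspace ?S2" "vec.subspace ?S3"
    by (simp_all add: vec.linear_subspace_image lin2 lin3 type20_subspace N_subspace)
  have zero20: "0 \<in> type20 \<psi>0" by (rule vec.subspace_0[OF type20_subspace])
  have zeroN: "0 \<in> N" by (rule vec.subspace_0[OF N_subspace])
  have "inj_on (\<lambda>K. tensor_spinor K \<psi>0) (type20 \<psi>0)"
  proof (rule inj_onI)
    fix K L assume KL: "K \<in> type20 \<psi>0" "L \<in> type20 \<psi>0" "tensor_spinor K \<psi>0 = tensor_spinor L \<psi>0"
    have "0 *s \<psi>0 + tensor_spinor (K - L) \<psi>0 + 0 \<odot> \<psi>bar = 0"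
      by (simp add: tensor_spinor_diff KL(3) act_simps)
    from components_eq_0(2)[OF this] have "K - L = 0"
      using KL(1,2) zeroN by (simp add: vec.subspace_diff[OF type20_subspace])
    thus "K = L" by simp
  qed
  hence dim2: "vec.dim ?S2 = vec.dim (type20 \<psi>0)"
    by (intro dim_image_subspace lin2 type20_subspace)
  have "inj_on (\<lambda>w. w \<odot> \<psi>bar) N"
  proof (rule inj_onI)
    fix w x assume wx: "w \<in> N" "x \<in> N" "w \<odot> \<psi>bar = x \<odot> \<psi>bar"
    have "0 *s \<psi>0 + tensor_spinor 0 \<psi>0 + (w - x) \<odot> \<psi>bar = 0"
      by (simp add: act_simps tensor_spinor_zero wx(3))
    from components_eq_0(3)[OF this zero20] show "w = x"
      using vec.subspace_diff[OF N_subspace wx(1,2)] by simp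
  qed
  hence dim3: "vec.dim ?S3 = 5"
    using dim_image_subspace[OF lin3 N_subspace] dim_N by simp
  have dim1: "vec.dim ?S1 = 1"
    using vacuum_nonzero vec.dim_eq_card_independent[of "{\<psi>0}"] by (simp add: vec.dim_span)
  let ?S12 = "{x + y | x y. x \<in> ?S1 \<and> y \<in> ?S2}"
  let ?S = "{x + y | x y. x \<in> ?S12 \<and> y \<in> ?S3}"
  have sub12: "vec.subspace ?S12" by (intro vec.subspace_sums sub)
  have subS: "vec.subspace ?S" by (intro vec.subspace_sums sub12 sub)
  have "?S1 \<inter> ?S2 = {0}"
  proof -
    have "x = 0" if x: "x \<in> ?S1" "x \<in> ?S2" for x
    proof -
      from x obtain f K where f: "x = f *s \<psi>0" and K: "K \<in> type20 \<psi>0" "x = tensor_spinor K \<psi>0"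
        unfolding vec.span_singleton by blast
      have "f *s \<psi>0 + tensor_spinor (- K) \<psi>0 + 0 \<odot> \<psi>bar = 0"
        unfolding tensor_spinor_minus K(2)[symmetric] f by (simp add: act_simps)
      from components_eq_0(1)[OF this] show ?thesis using K(1) zeroN f
        by (simp add: vec.subspace_neg[OF type20_subspace])
    qed
    thus ?thesis using vec.subspace_0 sub by blast
  qed
  hence dim12: "vec.dim ?S12 = 1 + vec.dim (type20 \<psi>0)"
    using vec.dim_sums_Int[OF sub(1,2)] dim1 dim2 by simp
  have "?S12 \<inter> ?S3 = {0}"
  proof -
    have "x = 0" if x: "x \<in> ?S12" "x \<in> ?S3" for x
    proof -
      from x obtain f K w where K: "K \<in> type20 \<psi>0" "x = f *s \<psi>0 + tensor_spinor K \<psi>0"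
        and w: "w \<in> N" "x = w \<odot> \<psi>bar"
        unfolding vec.span_singleton by blast
      have "f *s \<psi>0 + tensor_spinor K \<psi>0 + (- w) \<odot> \<psi>bar = 0"
        unfolding act_left w(2)[symmetric] K(2)[symmetric] by simp
      from components_eq_0(3)[OF this] show ?thesis using K w
        by (simp add: act_simps vec.subspace_neg[OF N_subspace])
    qed
    thus ?thesis using vec.subspace_0 sub sub12 by blast
  qed
  hence dimS: "vec.dim ?S = 6 + vec.dim (type20 \<psi>0)"
    using vec.dim_sums_Int[OF sub12 sub(3)] dim12 dim3 by simp
  have "?S \<subseteq> Delta_plus"
    by (auto simp: vec.span_singleton intro!: vec.subspace_add[OF Delta_plus_subspace]
        vec.subspace_scale[OF Delta_plus_subspace] chiral tensor_Delta_plus act_Delta_minus psibar_chiral)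
  note S_le = this
  have "6 + vec.dim (type20 \<psi>0) \<le> 16"
    using vec.dim_subset[OF S_le] dimS dim_Delta_plus by simp
  thus dim: "vec.dim (type20 \<psi>0) = 10"
    using dim_type20_ge by simp
  have S: "?S = Delta_plus"
    using dimS dim dim_Delta_plus
    by (intro vec.subspace_dim_equal subS Delta_plus_subspace S_le) simp
  show "\<exists>f. \<exists>K\<in>type20 \<psi>0. \<exists>w\<in>N. \<phi> = f *s \<psi>0 + tensor_spinor K \<psi>0 + w \<odot> \<psi>bar"
    if "\<phi> \<in> Delta_plus"
  proof -
    have "\<phi> \<in> ?S" unfolding S by (rule that)
    thus ?thesis unfolding vec.span_singleton by blast
  qed
qed

section \<open>The square of a (2,0) tensor\<close>

lemma hform_vacuum_pair:
  assumes "y \<in> Nbar"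
  shows "hform \<psi>0 (a \<odot> y \<odot> \<phi>) = 2 * cdot a y * hform \<psi>0 \<phi>"
  by (subst act_swap) (simp add: hform_simps hform_vacuum_Nbar[OF assms])

text \<open>
  The complex conjugate of a three-index form of \<open>\<psi>0\<close> with entries in \<open>Nbar\<close>, which is
  antisymmetric and so odd under reversal.
\<close>
lemma hform_vacuum_triple:
  assumes "x \<in> N" "y \<in> N" "z \<in> N"
  shows "hform \<psi>0 (x \<odot> y \<odot> z \<odot> \<psi>bar) = 0"
proof -
  let ?x = "vcnj x" and ?y = "vcnj y" and ?z = "vcnj z"
  have mem: "?x \<in> Nbar" "?y \<in> Nbar" "?z \<in> Nbar" using assms by (simp_all add: Nbar_def)
  have swap: "p \<odot> q \<odot> \<phi> = - (q \<odot> p \<odot> \<phi>)" if "p \<in> Nbar" "q \<in> Nbar" for p q \<phi>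
    by (subst act_swap) (simp add: Nbar_isotropic that)
  have "bform \<psi>0 (?z \<odot> ?y \<odot> ?x \<odot> \<psi>0) = bform (?x \<odot> ?y \<odot> ?z \<odot> \<psi>0) \<psi>0"
    by (simp add: bform_act)
  also have "\<dots> = bform \<psi>0 (?x \<odot> ?y \<odot> ?z \<odot> \<psi>0)"
    by (rule bform_commute)
  also have "?x \<odot> ?y \<odot> ?z \<odot> \<psi>0 = - (?z \<odot> ?y \<odot> ?x \<odot> \<psi>0)"
    using mem by (simp add: swap[of ?x ?y] swap[of ?x ?z] swap[of ?y ?z] act_simps)
  finally have "bform \<psi>0 (?z \<odot> ?y \<odot> ?x \<odot> \<psi>0) = 0"
    by (simp add: bform_simps)
  moreover have "hform \<psi>0 (x \<odot> y \<odot> z \<odot> \<psi>bar) = cnj (bform \<psi>0 (?z \<odot> ?y \<odot> ?x \<odot> \<psi>0))"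
    by (simp add: hform_act bform_eq_hform hform_cnj \<psi>bar_def)
  ultimately show ?thesis by simp
qed

lemma N_tensor_tensor_vacuum:
  assumes K: "K \<in> type20 \<psi>0" and a: "a \<in> N"
  shows "a \<odot> tensor_spinor K (tensor_spinor K \<psi>0) = - 8 *s (tensor_vec K a \<odot> tensor_spinor K \<psi>0)"
  using Nbar_tensor[OF K tensor_vec_in_Nbar[OF K]]
  by (simp add: act_tensor_spinor skew_type20[OF K] N_vacuum[OF a] tensor_vec_Nbar[OF K] tensor_vec_in_Nbar[OF K]
      tensor_spinor_right tensor_spinor_right_minus act_simps) (simp add: vec_eq_iff)

lemma Omega_in_N:
  assumes K: "K \<in> type20 \<psi>0"
  shows "Omega_KK \<psi>0 K \<in> N"
  by (rule in_N_if_orthogonal) (simp add: cdot_Omega_KK pure skew_type20[OF K] bform_vacuum_N)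

text \<open>
  Commuting \<open>a\<close> through three factors \<open>K\<close> gives \<open>a K K K \<psi>0 = -12 (K a) K K \<psi>0\<close>, while
  \<open>(\<psi>0 a \<phi>) = 0\<close> for every \<open>\<phi>\<close>.
\<close>
lemma cdot_tensor_vec_Omega:
  assumes K: "K \<in> type20 \<psi>0" and a: "a \<in> N"
  shows "cdot (tensor_vec K a) (Omega_KK \<psi>0 K) = 0"
proof -
  let ?T = "tensor_spinor K"
  have Ka: "tensor_vec K a \<in> Nbar" by (rule tensor_vec_in_Nbar[OF K])
  have "a \<odot> ?T (?T (?T \<psi>0)) = ?T (a \<odot> ?T (?T \<psi>0)) - 4 *s (tensor_vec K a \<odot> ?T (?T \<psi>0))"
    by (rule act_tensor_spinor[OF skew_type20[OF K]])
  also have "\<dots> = (- 12) *s (tensor_vec K a \<odot> ?T (?T \<psi>0))"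
    by (simp add: N_tensor_tensor_vacuum[OF K a] tensor_spinor_right tensor_spinor_right_minus Nbar_tensor[OF K Ka])
      (simp add: vec_eq_iff)
  finally have "bform \<psi>0 (tensor_vec K a \<odot> ?T (?T \<psi>0)) = 0"
    using bform_vacuum_N[OF a, of "?T (?T (?T \<psi>0))"] by (simp add: bform_simps)
  thus ?thesis by (simp add: cdot_Omega_KK pure skew_type20[OF K])
qed

text \<open>
  \<open>K K \<psi>0\<close> has four occupied levels, so only its component in \<open>N \<psi>bar\<close> survives. The
  pairing with \<open>Nbar \<psi>0\<close> identifies that component with the contraction of \<open>\<Omega>bar\<close>.
\<close>
lemma tensor_tensor_vacuum:
  assumes K: "K \<in> type20 \<psi>0"
  shows "tensor_spinor K (tensor_spinor K \<psi>0) = (2 * root2) *s (Omega_KK \<psi>0 K \<odot> \<psi>bar)"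
proof -
  let ?X = "tensor_spinor K (tensor_spinor K \<psi>0)" and ?O = "Omega_KK \<psi>0 K"
  have "?X \<in> Delta_plus" by (intro tensor_Delta_plus K chiral)
  then obtain f L w where L: "L \<in> type20 \<psi>0" and w: "w \<in> N"
    and X: "?X = f *s \<psi>0 + tensor_spinor L \<psi>0 + w \<odot> \<psi>bar"
    using spinor_decomposition by blast
  have "hform \<psi>0 ?X = f"
    unfolding X by (simp add: hform_simps hform_vacuum hform_vacuum_tensor[OF L] hform_vacuum_act_psibar)
  hence f: "f = 0" by (simp add: hform_vacuum_tensor[OF K])
  have "L = 0"
  proof (rule type20_eq_0[OF L])
    fix a assume a: "a \<in> N"
    show "tensor_vec L a = 0"
    proof (rule Nbar_eq_0[OF tensor_vec_in_Nbar[OF L]])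
      fix c assume c: "c \<in> N"
      have "hform \<psi>0 (c \<odot> a \<odot> ?X) = 0"
        by (simp add: N_tensor_tensor_vacuum[OF K a] act_simps hform_simps
            hform_vacuum_pair[OF tensor_vec_in_Nbar[OF K]] hform_vacuum_tensor[OF K])
      moreover have "hform \<psi>0 (c \<odot> a \<odot> ?X) = - 8 * cdot c (tensor_vec L a)"
        unfolding X f
        by (simp add: N_tensor_vacuum[OF L a] act_simps hform_simps hform_vacuum
            hform_vacuum_pair[OF tensor_vec_in_Nbar[OF L]] hform_vacuum_triple[OF c a w])
      ultimately show "cdot c (tensor_vec L a) = 0" by simp
    qed
  qed
  hence X: "?X = w \<odot> \<psi>bar" using X f by (simp add: tensor_spinor_zero)
  have "w - (2 * root2) *s ?O = 0"
  proof (rule N_eq_0)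
    show "w - (2 * root2) *s ?O \<in> N"
      by (intro vec.subspace_diff vec.subspace_scale N_subspace w Omega_in_N K)
    fix b assume b: "b \<in> Nbar"
    have "cdot b ?O = 1 / (4 * root2) * (2 * cdot w b)"
      by (simp only: cdot_Omega_KK[OF pure skew_type20[OF K]] X bform_vacuum_pair[OF b])
    thus "cdot (w - (2 * root2) *s ?O) b = 0"
      by (simp add: cdot_simps cdot_commute[of _ b] field_simps)
  qed
  thus ?thesis unfolding X by (simp add: act_simps flip: act_left)
qed

section \<open>The Pluecker relations in components\<close>

text \<open>
  The general chiral spinor, with \<open>K\<close> scaled as in the solution and \<open>w\<close> still free.
\<close>
definition spin_point :: "complex \<Rightarrow> tensor2 \<Rightarrow> cvec \<Rightarrow> spinor" where
  "spin_point f K w = f *s \<psi>0 - (1 / 8) *s tensor_spinor K \<psi>0 + w \<odot> \<psi>bar"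

context
  fixes K w and f :: complex
  assumes K: "K \<in> type20 \<psi>0" and w: "w \<in> N"
begin

lemma hform_spin_point: "hform \<psi>0 (spin_point f K w) = f"
  by (simp add: spin_point_def hform_simps hform_vacuum hform_vacuum_tensor[OF K] hform_vacuum_act_psibar)

lemma spin_point_Delta_plus: "spin_point f K w \<in> Delta_plus"
  unfolding spin_point_def
  by (intro vec.subspace_add vec.subspace_diff vec.subspace_scale Delta_plus_subspace chiral
      tensor_Delta_plus K act_Delta_minus psibar_chiral)

lemma N_spin_point:
  assumes a: "a \<in> N"
  shows "a \<odot> spin_point f K w = (1 / 2) *s (tensor_vec K a \<odot> \<psi>0) + a \<odot> w \<odot> \<psi>bar"
  by (simp add: spin_point_def act_simps N_vacuum[OF a] N_tensor_vacuum[OF K a])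

lemma Nbar_spin_point:
  assumes y: "y \<in> Nbar"
  shows "y \<odot> spin_point f K w
    = f *s (y \<odot> \<psi>0) - (1 / 8) *s (y \<odot> tensor_spinor K \<psi>0) + (2 * cdot w y) *s \<psi>bar"
  by (simp add: spin_point_def act_simps act_swap[of y w] Nbar_psibar[OF y] cdot_commute[of y])

lemma bform_tensor_psibar: "bform (tensor_spinor K \<phi>) \<psi>bar = 0"
  by (simp add: bform_tensor_spinor skew_type20 K tensor_psibar bform_simps)

text \<open>
  Of the six pairings between the components of the spinor and those of its image under \<open>a\<close>,
  only the two between \<open>K \<psi>0\<close> and \<open>w \<psi>bar\<close> survive, and they agree.
\<close>
lemma bform_N_spin_point:
  assumes a: "a \<in> N"
  shows "bform (spin_point f K w) (a \<odot> spin_point f K w) = 2 * cdot w (tensor_vec K a)"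
proof -
  let ?b = "tensor_vec K a" and ?k = "tensor_spinor K \<psi>0"
  have b: "?b \<in> Nbar" by (rule tensor_vec_in_Nbar[OF K])
  have 1: "bform ?k (?b \<odot> \<psi>0) = 0"
    using bform_vacuum_Nbar_tensor[OF K b] by (simp only: bform_act[of ?k] bform_commute[of "?b \<odot> ?k"])
  have 2: "bform ?k (a \<odot> w \<odot> \<psi>bar) = - 8 * cdot w ?b"
  proof -
    have "bform ?k (a \<odot> w \<odot> \<psi>bar) = - 4 * bform (?b \<odot> \<psi>0) (w \<odot> \<psi>bar)"
      by (simp only: bform_act[of ?k a] N_tensor_vacuum[OF K a] bform_simps_left)
    also have "bform (?b \<odot> \<psi>0) (w \<odot> \<psi>bar) = 2 * cdot w ?b"
      by (simp only: bform_act[symmetric] bform_vacuum_pair[OF b])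
    finally show ?thesis by simp
  qed
  have 3: "bform (w \<odot> \<psi>bar) (?b \<odot> \<psi>0) = 2 * cdot w ?b"
    by (subst bform_commute) (simp only: bform_act[symmetric] bform_vacuum_pair[OF b])
  have 4: "bform (w \<odot> \<psi>bar) (a \<odot> w \<odot> \<psi>bar) = 0"
  proof -
    have "w \<odot> a \<odot> w \<odot> \<psi>bar = 0"
      by (simp add: act_swap[of a w] N_isotropic a w act_simps act_act_self)
    thus ?thesis by (simp only: bform_act[symmetric] bform_simps)
  qed
  show ?thesis
    unfolding N_spin_point[OF a]
    by (simp add: spin_point_def bform_simps bform_simps_left bform_vacuum_act bform_vacuum_N[OF a] 1 2 3 4)
qed

text \<open>
  Now \<open>\<psi>0\<close> pairs with \<open>w \<psi>bar\<close>, and \<open>K \<psi>0\<close> with itself: the latter is the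
  contraction of \<open>\<Omega>bar\<close> with \<open>K\<close> twice.
\<close>
lemma bform_Nbar_spin_point:
  assumes y: "y \<in> Nbar"
  shows "bform (spin_point f K w) (y \<odot> spin_point f K w)
    = 4 * f * cdot w y - root2 / 16 * cdot (Omega_KK \<psi>0 K) y"
proof -
  let ?k = "tensor_spinor K \<psi>0"
  have 1: "bform ?k (y \<odot> \<psi>0) = 0"
    using bform_vacuum_Nbar_tensor[OF K y] by (simp only: bform_act[of ?k] bform_commute[of "y \<odot> ?k"])
  have 2: "bform ?k (y \<odot> ?k) = - 4 * root2 * cdot (Omega_KK \<psi>0 K) y"
  proof -
    have "bform ?k (y \<odot> ?k) = - bform \<psi>0 (y \<odot> tensor_spinor K ?k)"
      by (simp only: bform_tensor_spinor[OF skew_type20[OF K]] Nbar_tensor[OF K y])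
    also have "\<dots> = - 4 * root2 * cdot y (Omega_KK \<psi>0 K)"
      by (simp add: cdot_Omega_KK[OF pure skew_type20[OF K]])
    finally show ?thesis by (simp only: cdot_commute)
  qed
  have 3: "bform (w \<odot> \<psi>bar) (y \<odot> \<psi>0) = 2 * cdot w y"
    by (subst bform_commute) (simp only: bform_act[symmetric] bform_vacuum_pair[OF y])
  have 4: "bform (w \<odot> \<psi>bar) (y \<odot> ?k) = 0"
  proof -
    have "bform (w \<odot> \<psi>bar) (y \<odot> ?k) = bform ?k (y \<odot> w \<odot> \<psi>bar)"
      by (simp only: bform_act[of "w \<odot> \<psi>bar"] bform_commute)
    also have "y \<odot> w \<odot> \<psi>bar = (2 * cdot y w) *s \<psi>bar"
      by (simp add: act_swap[of y w] Nbar_psibar[OF y] act_simps)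
    finally show ?thesis by (simp add: bform_simps bform_tensor_psibar)
  qed
  have 5: "bform (w \<odot> \<psi>bar) \<psi>bar = 0"
    by (simp only: bform_commute[of "w \<odot> \<psi>bar"]) (simp add: bform_eq_hform \<psi>bar_def hform_vacuum_act_psibar[unfolded \<psi>bar_def])
  show ?thesis
    unfolding Nbar_spin_point[OF y]
    by (simp add: spin_point_def bform_simps bform_simps_left bform_vacuum_act bform_vacuum_Nbar_tensor[OF K y]
        bform_vacuum_psibar bform_tensor_psibar 1 2 3 4 5 algebra_simps)
qed

text \<open>
  The component of \<open>v \<psi>\<close> in \<open>Nbar \<psi>0\<close>, which fixes the \<open>(1,0)\<close> part of \<open>v\<close>.
\<close>
lemma hform_N_act_spin_point:
  assumes a: "a \<in> N" and u: "u \<in> N" and y: "y \<in> Nbar"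
  shows "hform \<psi>0 (a \<odot> (u + y) \<odot> spin_point f K w) = cdot a (2 *s (f *s y) + tensor_vec K u)"
  unfolding act_left N_spin_point[OF u] Nbar_spin_point[OF y]
  by (simp add: act_simps hform_simps hform_vacuum_pair[OF tensor_vec_in_Nbar[OF K]] hform_vacuum_pair[OF y]
      hform_vacuum hform_vacuum_tensor[OF K] hform_vacuum_triple[OF a u w] hform_vacuum_act_psibar cdot_simps)

end


lemma cdot_vector_of: "cdot v (\<chi> i. bil \<psi> (gamma i) \<psi>) = bform \<psi> (v \<odot> \<psi>)"
  by (simp add: cdot_def bil_eq_bform act_expand bform_sum_right bform_simps)

lemma eq_0_if_orthogonal:
  assumes "\<And>a. a \<in> N \<Longrightarrow> cdot a v = 0" "\<And>b. b \<in> Nbar \<Longrightarrow> cdot b v = 0"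
  shows "v = 0"
  using in_N_if_orthogonal[OF assms(1)] assms(2) by (intro N_eq_0) (auto simp: cdot_commute)

section \<open>The solutions\<close>

text \<open>
  The coefficient of \<open>\<psi>bar\<close> in the spinor and the \<open>(1,0)\<close> part of the vector of a solution.
\<close>
definition sol_w :: "tensor2 \<Rightarrow> cvec \<Rightarrow> complex \<Rightarrow> complex \<Rightarrow> cvec" where
  "sol_w K u s f = (1 / root2 * inverse f) *s (s *s u + (1 / 32) *s Omega_KK \<psi>0 K)"

definition sol_y :: "tensor2 \<Rightarrow> cvec \<Rightarrow> complex \<Rightarrow> cvec" where
  "sol_y K u f = (- (1 / 2) * inverse f) *s tensor_vec K u"

lemma sol_w_in_N: "K \<in> type20 \<psi>0 \<Longrightarrow> u \<in> N \<Longrightarrow> sol_w K u s f \<in> N"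
  unfolding sol_w_def by (intro vec.subspace_scale vec.subspace_add N_subspace Omega_in_N)

lemma sol_y_in_Nbar: "K \<in> type20 \<psi>0 \<Longrightarrow> sol_y K u f \<in> Nbar"
  unfolding sol_y_def by (intro vec.subspace_scale Nbar_subspace tensor_vec_in_Nbar)

lemma cdot_tensor_vec_self: "skew K \<Longrightarrow> cdot u (tensor_vec K u) = 0"
  using cdot_tensor_vec[of K u u] by (simp add: cdot_commute)

text \<open>
  The scalar terms vanish because \<open>K u\<close> is orthogonal to \<open>u\<close> and to \<open>\<Omega>bar K K\<close>. In \<open>v \<psi>\<close> the
  terms \<open>y \<psi>0\<close> and \<open>u K \<psi>0\<close> cancel, as do \<open>y K \<psi>0\<close> and \<open>u w \<psi>bar\<close>, the last one
  rewritten by means of \<open>K K \<psi>0 = 2 \<surd>2 \<Omega>bar K K \<psi>bar\<close>.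
\<close>
lemma solution_plucker:
  assumes K: "K \<in> type20 \<psi>0" and u: "u \<in> N" and f: "f \<noteq> 0"
  shows "plucker (sol_y K u f + u) (spin_point f K (sol_w K u s f)) s"
proof -
  let ?w = "sol_w K u s f" and ?y = "sol_y K u f" and ?O = "Omega_KK \<psi>0 K"
  let ?\<psi> = "spin_point f K ?w" and ?Ku = "tensor_vec K u"
  have w: "?w \<in> N" by (rule sol_w_in_N[OF K u])
  have y: "?y \<in> Nbar" by (rule sol_y_in_Nbar[OF K])
  have Ku: "?Ku \<in> Nbar" by (rule tensor_vec_in_Nbar[OF K])
  have uKu: "cdot u ?Ku = 0" by (rule cdot_tensor_vec_self[OF skew_type20[OF K]])
  have OKu: "cdot ?O ?Ku = 0" using cdot_tensor_vec_Omega[OF K u] by (simp add: cdot_commute)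
  have "cdot (?y + u) (?y + u) = 0"
    using uKu by (simp add: cdot_simps Nbar_isotropic[OF y y] N_isotropic[OF u u])
      (simp add: sol_y_def cdot_simps cdot_commute)
  moreover have "(?y + u) \<odot> ?\<psi> = 0"
  proof -
    have wy: "cdot ?w ?y = 0"
      by (simp add: sol_w_def sol_y_def cdot_simps uKu OKu)
    have uw: "u \<odot> ?w \<odot> \<psi>bar = (- 1 / (16 * f)) *s (?Ku \<odot> tensor_spinor K \<psi>0)"
    proof -
      have "?O \<odot> \<psi>bar = (1 / (2 * root2)) *s tensor_spinor K (tensor_spinor K \<psi>0)"
        by (simp add: tensor_tensor_vacuum[OF K])
      hence "u \<odot> ?O \<odot> \<psi>bar = (1 / (2 * root2) * - 8) *s (?Ku \<odot> tensor_spinor K \<psi>0)"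
        by (simp only: act_right N_tensor_tensor_vacuum[OF K u] vec.scale_scale)
      hence "u \<odot> ?w \<odot> \<psi>bar
          = (1 / root2 * inverse f * (1 / 32 * (1 / (2 * root2) * - 8))) *s (?Ku \<odot> tensor_spinor K \<psi>0)"
        by (simp only: sol_w_def act_left act_right act_act_self N_isotropic[OF u u] vec.scale_scale)
          simp
      also have "1 / root2 * inverse f * (1 / 32 * (1 / (2 * root2) * - 8)) = - 1 / (16 * f)"
        using f by (simp add: field_simps root2_square)
      finally show ?thesis .
    qed
    have "(?y + u) \<odot> ?\<psi> = (f * (- (1 / 2) * inverse f)) *s (?Ku \<odot> \<psi>0) + (1 / 2) *s (?Ku \<odot> \<psi>0)
        - ((1 / 8) * (- (1 / 2) * inverse f) - (- 1 / (16 * f))) *s (?Ku \<odot> tensor_spinor K \<psi>0)"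
      unfolding act_left(1) N_spin_point[OF K w u] Nbar_spin_point[OF K w y] wy uw
      by (simp only: sol_y_def act_left vec.scale_scale vec.scale_left_diff_distrib) (simp add: algebra_simps)
    also have "\<dots> = 0" using f by (simp add: field_simps vec_eq_iff)
    finally show ?thesis .
  qed
  moreover have "(2 * s) *s (?y + u) - (1 / root2) *s (\<chi> i. bil ?\<psi> (gamma i) ?\<psi>) = 0"
  proof (rule eq_0_if_orthogonal)
    fix a assume a: "a \<in> N"
    have aKu: "cdot u (tensor_vec K a) = - cdot a ?Ku"
      using cdot_tensor_vec[OF skew_type20[OF K], of u a] by (simp add: cdot_commute)
    have OKa: "cdot ?O (tensor_vec K a) = 0"
      using cdot_tensor_vec_Omega[OF K a] by (simp add: cdot_commute)
    have "cdot ?w (tensor_vec K a) = 1 / root2 * inverse f * (s * - cdot a ?Ku)"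
      by (simp add: sol_w_def cdot_simps aKu OKa)
    hence "1 / root2 * (2 * cdot ?w (tensor_vec K a)) = - (inverse f * s * cdot a ?Ku)"
      by (simp add: field_simps root2_square)
    moreover have "2 * s * cdot a ?y = - (inverse f * s * cdot a ?Ku)"
      by (simp add: sol_y_def cdot_simps)
    ultimately show "cdot a ((2 * s) *s (?y + u) - (1 / root2) *s (\<chi> i. bil ?\<psi> (gamma i) ?\<psi>)) = 0"
      by (simp only: cdot_simps cdot_vector_of bform_N_spin_point[OF K w a] N_isotropic[OF a u] add_0_right
          diff_self)
  next
    fix b assume b: "b \<in> Nbar"
    have "cdot b ?w = root2 / 2 * inverse f * (s * cdot b u + 1 / 32 * cdot b ?O)"
      by (simp only: sol_w_def cdot_simps inverse_root2)
    hence "root2 / 2 * (4 * f * cdot b ?w - root2 / 16 * cdot b ?O) = 2 * s * cdot b u"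
      using f by (simp add: field_simps root2_square)
    thus "cdot b ((2 * s) *s (?y + u) - (1 / root2) *s (\<chi> i. bil ?\<psi> (gamma i) ?\<psi>)) = 0"
      by (simp add: cdot_simps cdot_vector_of bform_Nbar_spin_point[OF K w b] Nbar_isotropic[OF b y]
          cdot_commute[of _ b] inverse_root2)
  qed
  ultimately show ?thesis by (simp add: plucker_def act_def)
qed

text \<open>
  Two components of the relations suffice for the converse: the one of \<open>v \<psi> = 0\<close> along
  \<open>Nbar \<psi>0\<close>, and the one of the quadratic relation that is seen by \<open>Nbar\<close>.
\<close>
lemma plucker_solution:
  assumes \<psi>: "\<psi> \<in> Delta_plus" "hform \<psi>0 \<psi> \<noteq> 0" and P: "plucker v \<psi> s"
  obtains K u f where "K \<in> type20 \<psi>0" "u \<in> N" "f \<noteq> 0" "v = sol_y K u f + u"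
    "\<psi> = spin_point f K (sol_w K u s f)"
proof -
  obtain f K' w where K': "K' \<in> type20 \<psi>0" and w: "w \<in> N"
    and dec: "\<psi> = f *s \<psi>0 + tensor_spinor K' \<psi>0 + w \<odot> \<psi>bar"
    using spinor_decomposition[OF \<psi>(1)] by blast
  define K where "K = (- 8) *s K'"
  have K: "K \<in> type20 \<psi>0"
    unfolding K_def by (intro vec.subspace_scale type20_subspace K')
  have dec: "\<psi> = spin_point f K w"
    by (simp add: dec spin_point_def K_def tensor_spinor_scale)
      (simp add: vec_eq_iff tensor_spinor_minus tensor_spinor_scale)
  have f: "f \<noteq> 0" using \<psi>(2) by (simp add: dec hform_spin_point[OF K w])
  obtain u y where uy: "u \<in> N" "y \<in> Nbar" "v = u + y" by (rule split_N_Nbar)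
  note u = uy(1) and y = uy(2)
  let ?O = "Omega_KK \<psi>0 K"
  have eq1: "(2 * s) *s v - (1 / root2) *s (\<chi> i. bil \<psi> (gamma i) \<psi>) = 0" and eq2: "v \<odot> \<psi> = 0"
    using P by (simp_all add: plucker_def act_def)
  have "2 *s (f *s y) + tensor_vec K u = 0"
  proof (rule Nbar_eq_0)
    show "2 *s (f *s y) + tensor_vec K u \<in> Nbar"
      by (intro vec.subspace_add vec.subspace_scale Nbar_subspace y tensor_vec_in_Nbar K)
    fix a assume a: "a \<in> N"
    show "cdot a (2 *s (f *s y) + tensor_vec K u) = 0"
      unfolding hform_N_act_spin_point[OF K w a u y, symmetric] using eq2
      by (simp add: uy(3) dec act_right hform_simps)
  qed
  hence "tensor_vec K u = (- 2 * f) *s y"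
    by (simp add: vec_eq_iff eq_neg_iff_add_eq_0 add.commute)
  hence y_eq: "y = sol_y K u f"
    using f by (simp add: sol_y_def vec_eq_iff)
  have "w - sol_w K u s f = 0"
  proof (rule N_eq_0)
    show "w - sol_w K u s f \<in> N"
      by (intro vec.subspace_diff N_subspace w sol_w_in_N K u)
    fix b assume b: "b \<in> Nbar"
    have "cdot b ((2 * s) *s v - (1 / root2) *s (\<chi> i. bil \<psi> (gamma i) \<psi>)) = 0"
      by (simp add: eq1 cdot_simps)
    hence "2 * s * cdot b u = 1 / root2 * (4 * f * cdot b w - root2 / 16 * cdot b ?O)"
      by (simp add: cdot_simps cdot_vector_of dec bform_Nbar_spin_point[OF K w b] uy(3) Nbar_isotropic[OF b y]
          cdot_commute[of _ b])
    hence "root2 * (2 * s * cdot b u) + root2 / 16 * cdot b ?O = 4 * f * cdot b w"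
      by simp
    hence "cdot b w = root2 / 2 * inverse f * (s * cdot b u + 1 / 32 * cdot b ?O)"
      using f by (simp add: field_simps)
    hence "cdot b w = 1 / root2 * inverse f * (s * cdot b u + 1 / 32 * cdot b ?O)"
      by (simp only: inverse_root2)
    thus "cdot (w - sol_w K u s f) b = 0"
      by (simp only: sol_w_def cdot_simps cdot_commute[of _ b] diff_self)
  qed
  hence "\<psi> = spin_point f K (sol_w K u s f)" using dec by simp
  thus thesis using K u f y_eq uy(3) by (intro that) (auto simp: add.commute)
qed

text \<open>
  The parameters are components of the solution: \<open>u\<close> is the \<open>N\<close> part of \<open>v\<close>, and \<open>f\<close> and \<open>K\<close>
  belong to the decomposition of \<open>\<psi>\<close>.
\<close>
lemma solution_inj:
  assumes "K \<in> type20 \<psi>0" "u \<in> N" "K' \<in> type20 \<psi>0" "u' \<in> N"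
    and v: "sol_y K u f + u = sol_y K' u' f' + u'"
    and \<psi>: "spin_point f K (sol_w K u s f) = spin_point f' K' (sol_w K' u' s f')"
  shows "K = K' \<and> u = u' \<and> f = f'"
proof -
  have w: "sol_w K u s f \<in> N" "sol_w K' u' s f' \<in> N"
    using assms by (auto intro: sol_w_in_N)
  have f: "f = f'"
    using hform_spin_point[OF assms(1) w(1), of f] hform_spin_point[OF assms(3) w(2), of f'] \<psi>
    by (simp only:)
  have "u - u' = sol_y K' u' f' - sol_y K u f"
    using v by (simp add: algebra_simps)
  moreover have "u - u' \<in> N" "sol_y K' u' f' - sol_y K u f \<in> Nbar"
    using assms by (auto intro!: vec.subspace_diff N_subspace Nbar_subspace sol_y_in_Nbar)
  ultimately have u: "u = u'"
    using N_Nbar_disjoint[of "u - u'"] by simp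
  have "0 *s \<psi>0 + tensor_spinor ((- (1 / 8)) *s (K - K')) \<psi>0 + (sol_w K u s f - sol_w K' u' s f') \<odot> \<psi>bar
      = spin_point f K (sol_w K u s f) - spin_point f' K' (sol_w K' u' s f')"
    unfolding spin_point_def f act_left tensor_spinor_scale tensor_spinor_diff
    by (simp add: vec_eq_iff algebra_simps)
  also have "\<dots> = 0" using \<psi> by simp
  finally have eq: "0 *s \<psi>0 + tensor_spinor ((- (1 / 8)) *s (K - K')) \<psi>0
      + (sol_w K u s f - sol_w K' u' s f') \<odot> \<psi>bar = 0" .
  have "(- (1 / 8)) *s (K - K') = 0"
    by (rule components_eq_0(2)[OF eq])
      (intro vec.subspace_diff vec.subspace_scale type20_subspace N_subspace w assms)+
  thus ?thesis using f u by simp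
qed

end

theorem proposition2p9:
  fixes \<psi>0 :: spinor
  assumes "\<psi>0 \<in> Delta_plus" and "pure_spinor \<psi>0" and "normalised \<psi>0"
  defines "sol_v \<equiv> \<lambda>(K :: tensor2) (u :: cvec) (f :: complex).
      (- (1 / 2) * inverse f) *s tensor_vec K u + u"
    and "sol_\<psi> \<equiv> \<lambda>(K :: tensor2) (u :: cvec) (s :: complex) (f :: complex).
      f *s \<psi>0 - (1 / 8) *s tensor_spinor K \<psi>0
      + (1 / complex_of_real (sqrt 2) * inverse f) *s
          (clifford (s *s u + (1 / 32) *s Omega_KK \<psi>0 K)
            *v (charge_conj *v spinor_cnj \<psi>0))"
  shows "bij_betw
      (\<lambda>(K, u, s, f). (sol_v K u f, sol_\<psi> K u s f, s))
      (type20 \<psi>0 \<times> type01 \<psi>0 \<times> UNIV \<times> (- {0}))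
      {(v, \<psi>, s). \<psi> \<in> Delta_plus \<and> herm \<psi>0 (mat 1) \<psi> \<noteq> 0 \<and> plucker v \<psi> s}
    \<and> (\<forall>K \<in> type20 \<psi>0. \<forall>u \<in> type01 \<psi>0. \<forall>s f. f \<noteq> 0 \<longrightarrow>
        herm \<psi>0 (mat 1) (sol_\<psi> K u s f) = f)
    \<and> vec.dim (type20 \<psi>0) + vec.dim (type01 \<psi>0) + 2 = 17"
proof -
  interpret pure_vacuum \<psi>0 using assms(1-3) by unfold_locales
  have v: "sol_v K u f = sol_y K u f + u" for K u f
    by (simp add: sol_v_def sol_y_def)
  have \<psi>: "sol_\<psi> K u s f = spin_point f K (sol_w K u s f)" for K u s f
    by (simp add: sol_\<psi>_def spin_point_def sol_w_def \<psi>bar_def majorana_def act_left flip: act_def)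
  have herm: "herm \<psi>0 (mat 1) \<phi> = hform \<psi>0 \<phi>" for \<phi>
    by (simp add: herm_eq_hform)
  have point: "hform \<psi>0 (spin_point f K (sol_w K u s f)) = f"
    "spin_point f K (sol_w K u s f) \<in> Delta_plus" if "K \<in> type20 \<psi>0" "u \<in> N" for K u s f
    using that by (simp_all add: hform_spin_point spin_point_Delta_plus sol_w_in_N)
  let ?F = "\<lambda>(K, u, s, f). (sol_v K u f, sol_\<psi> K u s f, s)"
  let ?P = "type20 \<psi>0 \<times> N \<times> UNIV \<times> (- {0})"
  let ?S = "{(v, \<psi>, s). \<psi> \<in> Delta_plus \<and> herm \<psi>0 (mat 1) \<psi> \<noteq> 0 \<and> plucker v \<psi> s}"
  have "bij_betw ?F ?P ?S"
  proof (rule bij_betw_imageI)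
    show "inj_on ?F ?P"
      unfolding v \<psi> by (rule inj_onI) (auto dest: solution_inj)
    have "?F p \<in> ?S" if "p \<in> ?P" for p
    proof -
      obtain K u s f where p: "p = (K, u, s, f)" by (cases p)
      with that have "K \<in> type20 \<psi>0" "u \<in> N" "f \<noteq> 0" by auto
      thus ?thesis unfolding p prod.case v \<psi> herm mem_Collect_eq
        by (simp only: point solution_plucker simp_thms)
    qed
    moreover have "q \<in> ?F ` ?P" if "q \<in> ?S" for q
    proof -
      obtain v' \<phi> s where q: "q = (v', \<phi>, s)" by (cases q)
      with that have "\<phi> \<in> Delta_plus" "hform \<psi>0 \<phi> \<noteq> 0" "plucker v' \<phi> s" by (auto simp: herm)
      then obtain K u f where "K \<in> type20 \<psi>0" "u \<in> N" "f \<noteq> 0" "v' = sol_y K u f + u"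
        "\<phi> = spin_point f K (sol_w K u s f)" by (rule plucker_solution)
      thus ?thesis unfolding q v \<psi> by (intro image_eqI[of _ _ "(K, u, s, f)"]) auto
    qed
    ultimately show "?F ` ?P = ?S"
      by (intro subset_antisym image_subsetI subsetI)
  qed
  thus ?thesis
    unfolding type01_eq_N herm \<psi>
    using dim_type20 dim_N by (simp add: point)
qed

end
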